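(* For every real $s>\max\{\bar z,\kappa\}$, $$\widetilde U(s)=(\mathcal R(AB))(s).$$
   Context: Model. Let $E=\{1,\dots,m\}$; for each $i\in E$ let $c_i>0$, $\lambda_i>0$, $p_i\in(0,1)$, and let $Q=(q_{ij})_{i,j\in E}$ be a stochastic matrix. $(X,J)$ is the Markov process on $[0,\infty)\times E$ with the following dynamics: while the phase $J$ equals $i$, the level $X$ increases linearly with slope $1/c_i$ and the next jump occurs at rate $\lambda_i$; at a jump from $(x,i)$ the process moves to $(p_i x,j)$ with probability $q_{ij}$ ($j=i$ is allowed). $\mathbb E_{x,i}$ denotes expectation given $(X(0),J(0))=(x,i)$. Fix $w>0$. Put $z_i=c_i(\lambda_i+w)$, $\gamma_i=c_i\lambda_i/p_i$, $\bar z=\max_i z_i$. For a matrix $M$, $|M|=\max_i\sum_j|M_{ij}|$. For $a\ge0$ let $\tau_{\uparrow a}=\inf\{t\ge0:X(t)\ge a\}$ and let $Z^{\uparrow}(0,a)$ be the matrix with entries $\mathbb E_{0,i}[e^{-w\tau_{\uparrow a}};J(\tau_{\uparrow a})=j]$ (contribution of $\{\tau_{\uparrow a}=\infty\}$ equal to $0$). This matrix is invertible for every $a\ge0$; set $U(a)=Z^{\uparrow}(0,a)^{-1}$. There exist constants $C_1,\kappa<\infty$ with $|U(a)|\le C_1e^{\kappa a}$ for all $a\ge0$; fix such constants. For $s>\kappa$ set $\widetilde U(s)=\int_0^\infty e^{-sa}U(a)\,da$. $E_i$ is the $m\times m$ matrix whose only nonzero entry is a $1$ in position $(i,i)$, and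 $$A(s)=\mathrm{diag}\Big(\frac{\gamma_1}{z_1-s},\dots,\frac{\gamma_m}{z_m-s}\Big),\qquad B=-\mathrm{diag}(1/\gamma_1,\dots,1/\gamma_m).$$ For a finite word $\alpha=(i_1,\dots,i_n)\in E^n$, $n\ge1$, put $|\alpha|=n$, $p_\alpha=\prod_{\ell=1}^np_{i_\ell}$, $\alpha\upharpoonright_k=(i_1,\dots,i_k)$ and $$K_\alpha(s)=A(s)E_{i_1}Q\prod_{k=2}^{n}A\big(s/p_{\alpha\upharpoonright_{k-1}}\big)E_{i_k}Q$$ (product ordered from left to right in increasing $k$; empty product $=I$). For a matrix-valued function $G$, $$(\mathcal R G)(s)=G(s)+\sum_{n\ge1}\sum_{|\alpha|=n}K_\alpha(s)\,G(s/p_\alpha),$$ whenever the series converges. Here $AB$ is the function $s\mapsto A(s)B$. *)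

theory Defs
  imports "HOL-Probability.Probability"
begin

(* The phase space E = {1..m} is a finite type 'm; N is the underlying measurable space and P x i
   the law of the process started in (x, i), so E_{x,i} is integration against P x i.
   T n is the length of the n-th inter-jump period and Y n the phase during that period. Jumps from
   a phase to itself are jumps too (they multiply the level by p), so Y n = Y (Suc n) is possible. *)

definition jump_time :: "(nat \<Rightarrow> 'a \<Rightarrow> real) \<Rightarrow> nat \<Rightarrow> 'a \<Rightarrow> real" where
  "jump_time T n \<omega> = (\<Sum>k<n. T k \<omega>)"

locale level_phase_process =
  fixes c lam p :: "'m::finite \<Rightarrow> real"
    and Q :: "real^'m^'m"
    and N :: "'a measure"
    and P :: "real \<Rightarrow> 'm \<Rightarrow> 'a measure"
    and X :: "real \<Rightarrow> 'a \<Rightarrow> real"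
    and J :: "real \<Rightarrow> 'a \<Rightarrow> 'm"
    and T :: "nat \<Rightarrow> 'a \<Rightarrow> real"
    and Y :: "nat \<Rightarrow> 'a \<Rightarrow> 'm"
  assumes c_pos: "0 < c i"
    and rate_pos: "0 < lam i"
    and p_bounds: "0 < p i" "p i < 1"
    and Q_nonneg: "0 \<le> Q $ i $ j"
    and Q_row_sum: "(\<Sum>j\<in>UNIV. Q $ i $ j) = 1"
    and prob_law: "0 \<le> x \<Longrightarrow> P x i \<in> space (prob_algebra N)"
    and measurable_X0: "X 0 \<in> borel_measurable N"
    and measurable_T: "T n \<in> borel_measurable N"
    and measurable_Y: "Y n \<in> measurable N (count_space UNIV)"
    (* path structure, with right-continuous paths and finitely many jumps in bounded time *)
    and X0_nonneg: "\<omega> \<in> space N \<Longrightarrow> 0 \<le> X 0 \<omega>"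
    and T_pos: "\<omega> \<in> space N \<Longrightarrow> 0 < T n \<omega>"
    and no_explosion: "\<omega> \<in> space N \<Longrightarrow> filterlim (\<lambda>n. jump_time T n \<omega>) at_top sequentially"
    and level_between_jumps:
      "\<omega> \<in> space N \<Longrightarrow> jump_time T n \<omega> \<le> t \<Longrightarrow> t < jump_time T (Suc n) \<omega> \<Longrightarrow>
        X t \<omega> = X (jump_time T n \<omega>) \<omega> + (t - jump_time T n \<omega>) / c (Y n \<omega>)"
    and phase_between_jumps:
      "\<omega> \<in> space N \<Longrightarrow> jump_time T n \<omega> \<le> t \<Longrightarrow> t < jump_time T (Suc n) \<omega> \<Longrightarrow> J t \<omega> = Y n \<omega>"
    and level_at_jump:
      "\<omega> \<in> space N \<Longrightarrow>
        X (jump_time T (Suc n) \<omega>) \<omega> =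
          p (Y n \<omega>) * (X (jump_time T n \<omega>) \<omega> + T n \<omega> / c (Y n \<omega>))"
    (* law: (Y n) is a Markov chain with transition matrix Q and, given (Y n), the T n are
       independent with T n exponential of rate lam (Y n) *)
    and start_level: "0 \<le> x \<Longrightarrow> AE \<omega> in P x i. X 0 \<omega> = x"
    and jump_law:
      "0 \<le> x \<Longrightarrow> (\<And>k. S k \<in> sets borel) \<Longrightarrow>
        measure (P x i) {\<omega> \<in> space N. \<forall>k\<le>n. Y k \<omega> = y k \<and> T k \<omega> \<in> S k} =
          of_bool (y 0 = i) * (\<Prod>k<n. Q $ y k $ y (Suc k)) *
          (\<Prod>k\<le>n. measure (density lborel (exponential_density (lam (y k)))) (S k))"

definition hitting_time_up :: "(real \<Rightarrow> 'a \<Rightarrow> real) \<Rightarrow> real \<Rightarrow> 'a \<Rightarrow> ereal" where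
  "hitting_time_up X a \<omega> = Inf (ereal ` {t. 0 \<le> t \<and> a \<le> X t \<omega>})"

definition Z_up ::
  "(real \<Rightarrow> 'm::finite \<Rightarrow> 'a measure) \<Rightarrow> (real \<Rightarrow> 'a \<Rightarrow> real) \<Rightarrow> (real \<Rightarrow> 'a \<Rightarrow> 'm) \<Rightarrow> real
    \<Rightarrow> real \<Rightarrow> real \<Rightarrow> real^'m^'m" where
  "Z_up P X J w x a = (\<chi> i j. \<integral>\<omega>.
     (let \<tau> = hitting_time_up X a \<omega> in
       if \<tau> = \<infinity> then 0
       else exp (- w * real_of_ereal \<tau>) * of_bool (J (real_of_ereal \<tau>) \<omega> = j)) \<partial>P x i)"

definition U_mat ::
  "(real \<Rightarrow> 'm::finite \<Rightarrow> 'a measure) \<Rightarrow> (real \<Rightarrow> 'a \<Rightarrow> real) \<Rightarrow> (real \<Rightarrow> 'a \<Rightarrow> 'm) \<Rightarrow> real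
    \<Rightarrow> real \<Rightarrow> real^'m^'m" where
  "U_mat P X J w a = matrix_inv (Z_up P X J w 0 a)"

definition laplace_mat :: "(real \<Rightarrow> real^'m^'m) \<Rightarrow> real \<Rightarrow> real^'m::finite^'m" where
  "laplace_mat F s = (LINT a:{0..}|lborel. exp (- s * a) *\<^sub>R F a)"

definition row_sum_norm :: "real^'m^'m::finite \<Rightarrow> real" where
  "row_sum_norm M = (MAX i. \<Sum>j\<in>UNIV. \<bar>M $ i $ j\<bar>)"

definition diag_mat :: "('m::finite \<Rightarrow> real) \<Rightarrow> real^'m^'m" where
  "diag_mat d = (\<chi> i j. if i = j then d i else 0)"

definition E_mat :: "'m::finite \<Rightarrow> real^'m^'m" where
  "E_mat i = (\<chi> k l. if k = i \<and> l = i then 1 else 0)"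

definition z_par :: "('m \<Rightarrow> real) \<Rightarrow> ('m \<Rightarrow> real) \<Rightarrow> real \<Rightarrow> 'm \<Rightarrow> real" where
  "z_par c lam w i = c i * (lam i + w)"

definition gamma_par :: "('m \<Rightarrow> real) \<Rightarrow> ('m \<Rightarrow> real) \<Rightarrow> ('m \<Rightarrow> real) \<Rightarrow> 'm \<Rightarrow> real" where
  "gamma_par c lam p i = c i * lam i / p i"

definition A_mat ::
  "('m::finite \<Rightarrow> real) \<Rightarrow> ('m \<Rightarrow> real) \<Rightarrow> ('m \<Rightarrow> real) \<Rightarrow> real \<Rightarrow> real \<Rightarrow> real^'m^'m" where
  "A_mat c lam p w s = diag_mat (\<lambda>i. gamma_par c lam p i / (z_par c lam w i - s))"

definition B_mat :: "('m::finite \<Rightarrow> real) \<Rightarrow> ('m \<Rightarrow> real) \<Rightarrow> ('m \<Rightarrow> real) \<Rightarrow> real^'m^'m" where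
  "B_mat c lam p = - diag_mat (\<lambda>i. 1 / gamma_par c lam p i)"

definition p_word :: "('m \<Rightarrow> real) \<Rightarrow> 'm list \<Rightarrow> real" where
  "p_word p \<alpha> = prod_list (map p \<alpha>)"

(* Letters are indexed from 0 here: the factor for k = 0 is A(s) E Q, as p_word p [] = 1.
   The product is written with foldr because the multiplication that prod_list would use on
   real^'m^'m is the componentwise one. *)
definition K_mat ::
  "('m::finite \<Rightarrow> real) \<Rightarrow> ('m \<Rightarrow> real) \<Rightarrow> ('m \<Rightarrow> real) \<Rightarrow> real^'m^'m \<Rightarrow> real
    \<Rightarrow> 'm list \<Rightarrow> real \<Rightarrow> real^'m^'m" where
  "K_mat c lam p Q w \<alpha> s =
     foldr (\<lambda>k M. (A_mat c lam p w (s / p_word p (take k \<alpha>)) ** E_mat (\<alpha> ! k) ** Q) ** M)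
       [0..<length \<alpha>] (mat 1)"

definition R_level ::
  "('m::finite \<Rightarrow> real) \<Rightarrow> ('m \<Rightarrow> real) \<Rightarrow> ('m \<Rightarrow> real) \<Rightarrow> real^'m^'m \<Rightarrow> real
    \<Rightarrow> (real \<Rightarrow> real^'m^'m) \<Rightarrow> real \<Rightarrow> nat \<Rightarrow> real^'m^'m" where
  "R_level c lam p Q w G s n =
     (\<Sum>\<alpha> | length \<alpha> = n. K_mat c lam p Q w \<alpha> s ** G (s / p_word p \<alpha>))"

definition R_op ::
  "('m::finite \<Rightarrow> real) \<Rightarrow> ('m \<Rightarrow> real) \<Rightarrow> ('m \<Rightarrow> real) \<Rightarrow> real^'m^'m \<Rightarrow> real
    \<Rightarrow> (real \<Rightarrow> real^'m^'m) \<Rightarrow> real \<Rightarrow> real^'m^'m" where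
  "R_op c lam p Q w G s = G s + (\<Sum>n. R_level c lam p Q w G s (Suc n))"

definition R_converges ::
  "('m::finite \<Rightarrow> real) \<Rightarrow> ('m \<Rightarrow> real) \<Rightarrow> ('m \<Rightarrow> real) \<Rightarrow> real^'m^'m \<Rightarrow> real
    \<Rightarrow> (real \<Rightarrow> real^'m^'m) \<Rightarrow> real \<Rightarrow> bool" where
  "R_converges c lam p Q w G s \<longleftrightarrow> summable (\<lambda>n. R_level c lam p Q w G s (Suc n))"

end

theory Submission
  imports Defs
begin

text \<open>
  Let $V$ solve the pantograph system
  $V_{ij}'(x) = z_i V_{ij}(x) - c_i \lambda_i \sum_k q_{ik} V_{kj}(p_i x)$, $V(0) = I$;
  its power series converges everywhere because $p_i < 1$. Along the jump chain, the discounted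
  value of a column of $V$ at the current state, frozen at its value on the boundary once the
  level has crossed $a$, is a bounded martingale. Letting the number of jumps tend to infinity gives
  $Z^{\uparrow}(x,a) V(a) = V(x)$ for $0 \le x \le a$, and $x = 0$ yields $U = V$ without
  any appeal to the strong Markov property. Taking Laplace transforms of the differential equation,
  $\widetilde U(s) = A(s) B + \sum_i A(s) E_i Q \, \widetilde U(s/p_i)$. Iterating this $N$ times
  produces the first $N$ levels of the series and a remainder that is
  $O(\prod_{k<N} D r^k / s)$ with $r = \max_i p_i < 1$.
\<close>

section \<open>Power series solution of a pantograph system\<close>

text \<open>The equation for V encodes one period of the process. If phase i is entered at level L,
  it says that exp(-(lam_i + w) t) V_i(L + t/c_i), where V_i is an entry of row i in a fixed column,
  has derivative -lam_i exp(-(lam_i + w) t) times the q-average of V at the post-jump level p_i (L +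
  t/c_i). Integrated up to the time at which the level would reach a, this is the one-step
  martingale identity. The law is known only through finite stretches of phases and periods.
  Conditional expectations are therefore replaced by a sum over finite phase words and an integral
  over a product of exponential laws, in which the last period is integrated first. The growth rate
  of V is not read off from its power series, which would give a rate of its own. It is inherited
  from the assumed bound on U through U = V, so the transform exists for every s >
  \<open>\<kappa>\<close>. The iteration converges because each step raises the argument from s to
  s/p_i, where A is smaller; the gain r^k at depth k beats any constant.\<close>

primrec panto_coeff ::
  "('m::finite \<Rightarrow> real) \<Rightarrow> ('m \<Rightarrow> 'm \<Rightarrow> real) \<Rightarrow> ('m \<Rightarrow> real) \<Rightarrow> ('m \<Rightarrow> real) \<Rightarrow> nat \<Rightarrow> 'm \<Rightarrow> real" where
  "panto_coeff z B r b 0 = b"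
| "panto_coeff z B r b (Suc n) = (\<lambda>i. (z i * panto_coeff z B r b n i
     - r i ^ n * (\<Sum>k\<in>UNIV. B i k * panto_coeff z B r b n k)) / real (Suc n))"

definition panto ::
  "('m::finite \<Rightarrow> real) \<Rightarrow> ('m \<Rightarrow> 'm \<Rightarrow> real) \<Rightarrow> ('m \<Rightarrow> real) \<Rightarrow> ('m \<Rightarrow> real) \<Rightarrow> 'm \<Rightarrow> real \<Rightarrow> real" where
  "panto z B r b i x = (\<Sum>n. panto_coeff z B r b n i * x ^ n)"

text \<open>Since |r i| \<le> 1, the delayed term costs no more than an undelayed one. The
  coefficients are thus dominated by those of D exp(C x), where C exceeds every absolute row sum of
  the system.\<close>

lemma panto_coeff_bound:
  fixes z :: "'m::finite \<Rightarrow> real"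
  assumes r: "\<And>i. \<bar>r i\<bar> \<le> 1"
  shows "\<exists>C D. \<forall>n i. \<bar>panto_coeff z B r b n i\<bar> \<le> D * (C ^ n / fact n)"
proof -
  define C where "C = (\<Sum>i\<in>UNIV. \<bar>z i\<bar> + (\<Sum>k\<in>UNIV. \<bar>B i k\<bar>))"
  define D where "D = (\<Sum>i\<in>UNIV. \<bar>b i\<bar>)"
  have "\<bar>panto_coeff z B r b n i\<bar> \<le> D * (C ^ n / fact n)" for n i
  proof (induction n arbitrary: i)
    case 0
    show ?case by (auto simp: D_def intro!: member_le_sum)
  next
    case (Suc n)
    define M where "M = D * (C ^ n / fact n)"
    have IH: "\<bar>panto_coeff z B r b n i\<bar> \<le> M" for i
      unfolding M_def by (rule Suc.IH)
    have M: "M \<ge> 0" using IH[of i] by linarith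
    have Ci: "\<bar>z i\<bar> + (\<Sum>k\<in>UNIV. \<bar>B i k\<bar>) \<le> C"
      unfolding C_def
      by (rule member_le_sum[where f="\<lambda>i. \<bar>z i\<bar> + (\<Sum>k\<in>UNIV. \<bar>B i k\<bar>)"]) (auto intro!: add_nonneg_nonneg sum_nonneg)
    have "\<bar>r i ^ n * (\<Sum>k\<in>UNIV. B i k * panto_coeff z B r b n k)\<bar>
        \<le> 1 * (\<Sum>k\<in>UNIV. \<bar>B i k\<bar> * M)"
      unfolding abs_mult power_abs
    proof (rule mult_mono)
      show "\<bar>\<Sum>k\<in>UNIV. B i k * panto_coeff z B r b n k\<bar> \<le> (\<Sum>k\<in>UNIV. \<bar>B i k\<bar> * M)"
        by (rule order_trans[OF sum_abs], rule sum_mono)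
          (unfold abs_mult, intro mult_left_mono IH abs_ge_zero)
    qed (auto intro: power_le_one r)
    moreover have "\<bar>z i * panto_coeff z B r b n i\<bar> \<le> \<bar>z i\<bar> * M"
      unfolding abs_mult by (intro mult_left_mono IH) auto
    ultimately have "\<bar>z i * panto_coeff z B r b n i
        - r i ^ n * (\<Sum>k\<in>UNIV. B i k * panto_coeff z B r b n k)\<bar>
        \<le> (\<bar>z i\<bar> + (\<Sum>k\<in>UNIV. \<bar>B i k\<bar>)) * M"
      by (simp add: distrib_right sum_distrib_right)
    also have "\<dots> \<le> C * M" using Ci M by (rule mult_right_mono)
    finally have "\<bar>z i * panto_coeff z B r b n i
        - r i ^ n * (\<Sum>k\<in>UNIV. B i k * panto_coeff z B r b n k)\<bar> / real (Suc n) \<le> C * M / real (Suc n)"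
      by (rule divide_right_mono) simp
    moreover have "C * M / real (Suc n) = D * (C ^ Suc n / fact (Suc n))"
      by (simp add: M_def divide_simps del: of_nat_Suc)
    ultimately show ?case
      by (simp add: abs_divide del: of_nat_Suc)
  qed
  then show ?thesis by blast
qed

lemma panto_summable:
  assumes "\<And>i. \<bar>r i\<bar> \<le> 1"
  shows "summable (\<lambda>n. panto_coeff z B r b n i * x ^ n)"
proof -
  obtain C D where CD: "\<And>n i. \<bar>panto_coeff z B r b n i\<bar> \<le> D * (C ^ n / fact n)"
    using panto_coeff_bound[where r=r and z=z and B=B and b=b] assms by blast
  show ?thesis
  proof (rule summable_comparison_test')
    show "summable (\<lambda>n. D * ((C * \<bar>x\<bar>) ^ n /\<^sub>R fact n))"
      by (intro summable_mult summable_exp_generic)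
    show "norm (panto_coeff z B r b n i * x ^ n) \<le> D * ((C * \<bar>x\<bar>) ^ n /\<^sub>R fact n)" for n
    proof -
      have "norm (panto_coeff z B r b n i * x ^ n) \<le> D * (C ^ n / fact n) * \<bar>x\<bar> ^ n"
        using mult_right_mono[OF CD[of n i], of "\<bar>x\<bar> ^ n"] by (simp add: abs_mult power_abs)
      also have "\<dots> = D * ((C * \<bar>x\<bar>) ^ n /\<^sub>R fact n)"
        by (simp add: power_mult_distrib divide_inverse mult_ac)
      finally show ?thesis .
    qed
  qed
qed

lemma panto_0 [simp]: "panto z B r b i 0 = b i"
  using powser_zero[of "\<lambda>n. panto_coeff z B r b n i"] by (simp add: panto_def)

lemma panto_has_derivative:
  fixes z :: "'m::finite \<Rightarrow> real"
  assumes r: "\<And>i. \<bar>r i\<bar> \<le> 1"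
  shows "(panto z B r b i has_real_derivative
      z i * panto z B r b i x - (\<Sum>k\<in>UNIV. B i k * panto z B r b k (r i * x))) (at x)"
proof -
  let ?a = "panto_coeff z B r b"
  have s: "summable (\<lambda>n. ?a n k * y ^ n)" for k y
    by (rule panto_summable[OF r])
  \<comment> \<open>The factor \<open>Suc n\<close> from \<open>diffs\<close> cancels the
    denominator of the recursion, and \<open>r i ^ n * x ^ n\<close> is the n-th power of the
    delayed argument.\<close>
  have d: "diffs (\<lambda>n. ?a n i) n * x ^ n
      = z i * (?a n i * x ^ n) - (\<Sum>k\<in>UNIV. B i k * (?a n k * (r i * x) ^ n))" for n
    by (simp add: diffs_def field_simps sum_distrib_left power_mult_distrib sum_subtractf)
  have "(\<lambda>n. diffs (\<lambda>n. ?a n i) n * x ^ n) sums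
      (z i * panto z B r b i x - (\<Sum>k\<in>UNIV. B i k * panto z B r b k (r i * x)))"
    unfolding d panto_def by (intro sums_diff sums_mult sums_sum summable_sums s)
  moreover have "((\<lambda>x. \<Sum>n. ?a n i * x ^ n) has_real_derivative
      (\<Sum>n. diffs (\<lambda>n. ?a n i) n * x ^ n)) (at x)"
    by (rule termdiffs_strong_converges_everywhere) (rule s)
  moreover have "panto z B r b i = (\<lambda>x. \<Sum>n. ?a n i * x ^ n)"
    by (rule ext) (rule panto_def)
  ultimately show ?thesis
    by (simp add: sums_iff)
qed

lemma continuous_on_panto:
  assumes "\<And>i. \<bar>r i\<bar> \<le> 1"
  shows "continuous_on S (panto z B r b i)"
  by (intro continuous_at_imp_continuous_on ballI DERIV_isCont[OF panto_has_derivative] assms)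

section \<open>Iterating the operator $\mathcal R$\<close>

lemma R_level_0 [simp]: "R_level c lam p Q w G s 0 = G s"
  by (simp add: R_level_def K_mat_def p_word_def)

lemma p_word_Cons: "p_word p (i # \<alpha>) = p i * p_word p \<alpha>"
  by (simp add: p_word_def)

text \<open>Splitting at the front is what makes the word recursive: every later prefix contains the
  letter i, so all remaining arguments carry the same factor 1 / p i and form the kernel of
  \<open>\<alpha>\<close> at s / p i.\<close>

lemma K_mat_Cons:
  "K_mat c lam p Q w (i # \<alpha>) s
    = A_mat c lam p w s ** E_mat i ** Q ** K_mat c lam p Q w \<alpha> (s / p i)"
proof -
  have "[0..<length (i # \<alpha>)] = 0 # map Suc [0..<length \<alpha>]"
    by (simp add: map_Suc_upt upt_conv_Cons del: upt_Suc)
  then show ?thesis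
    by (simp add: K_mat_def foldr_map comp_def p_word_Cons p_word_def[of p "[]"]
        del: upt_Suc list.size)
qed

lemma A_E_Q_mult_nth:
  "(A_mat c lam p w s ** E_mat i ** Q ** M) $ k $ l
    = (if k = i then gamma_par c lam p i / (z_par c lam w i - s) * (\<Sum>m\<in>UNIV. Q $ i $ m * M $ m $ l) else 0)"
proof -
  let ?a = "gamma_par c lam p i / (z_par c lam w i - s)"
  have "(A_mat c lam p w s ** E_mat i) $ k $ m = (\<Sum>j\<in>UNIV. if j = k then (if k = i \<and> m = i then ?a else 0) else 0)" for m
    unfolding matrix_matrix_mult_def A_mat_def diag_mat_def E_mat_def vec_lambda_beta
    by (intro sum.cong) auto
  then have AE: "(A_mat c lam p w s ** E_mat i) $ k $ m = (if k = i \<and> m = i then ?a else 0)" for m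
    by simp
  have "(A_mat c lam p w s ** E_mat i ** Q) $ k $ m
      = (\<Sum>j\<in>UNIV. (A_mat c lam p w s ** E_mat i) $ k $ j * Q $ j $ m)" for m
    by (simp add: matrix_matrix_mult_def)
  also have "\<dots> m = (\<Sum>j\<in>UNIV. if j = i then (if k = i then ?a * Q $ i $ m else 0) else 0)" for m
    unfolding AE by (intro sum.cong) auto
  finally have AEQ: "(A_mat c lam p w s ** E_mat i ** Q) $ k $ m = (if k = i then ?a * Q $ i $ m else 0)" for m
    by simp
  have "(A_mat c lam p w s ** E_mat i ** Q ** M) $ k $ l
      = (\<Sum>m\<in>UNIV. (A_mat c lam p w s ** E_mat i ** Q) $ k $ m * M $ m $ l)"
    by (simp add: matrix_matrix_mult_def)
  also have "\<dots> = (if k = i then ?a * (\<Sum>m\<in>UNIV. Q $ i $ m * M $ m $ l) else 0)"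
    unfolding AEQ by (cases "k = i") (simp_all add: sum_distrib_left mult.assoc)
  finally show ?thesis .
qed

text \<open>The matrix E of the first letter keeps a single row, so row k sees only the words that
  start with k. This leaves an entrywise recursion in n, which replaces the sum over words in the
  iteration and in the estimates.\<close>

lemma R_level_Suc_nth:
  "R_level c lam p Q w G s (Suc n) $ k $ l
    = gamma_par c lam p k / (z_par c lam w k - s)
      * (\<Sum>m\<in>UNIV. Q $ k $ m * R_level c lam p Q w G (s / p k) n $ m $ l)"
proof -
  let ?W = "{\<alpha> :: 'a list. length \<alpha> = n}"
  let ?K = "K_mat c lam p Q w"
  let ?a = "\<lambda>k. gamma_par c lam p k / (z_par c lam w k - s)"
  have W: "finite ?W"
    using finite_lists_length_eq[of "UNIV :: 'a set" n] by simp
  have words: "{\<alpha> :: 'a list. length \<alpha> = Suc n} = (\<lambda>(i, \<alpha>). i # \<alpha>) ` (UNIV \<times> ?W)"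
    by (auto simp: length_Suc_conv image_iff)
  have inj: "inj_on (\<lambda>(i, \<alpha>). i # \<alpha>) (UNIV \<times> ?W)"
    by (auto simp: inj_on_def)
  have "R_level c lam p Q w G s (Suc n)
      = (\<Sum>i\<in>UNIV. \<Sum>\<alpha>\<in>?W. A_mat c lam p w s ** E_mat i ** Q ** (?K \<alpha> (s / p i) ** G (s / p i / p_word p \<alpha>)))"
    unfolding R_level_def words
    by (subst sum.reindex[OF inj])
       (simp add: sum.cartesian_product split_def K_mat_Cons p_word_Cons matrix_mul_assoc)
  then have "R_level c lam p Q w G s (Suc n) $ k $ l
      = (\<Sum>i\<in>UNIV. \<Sum>\<alpha>\<in>?W. if k = i then ?a i * (\<Sum>m\<in>UNIV. Q $ i $ m *
          (?K \<alpha> (s / p i) ** G (s / p i / p_word p \<alpha>)) $ m $ l) else 0)"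
    by (simp only: sum_component A_E_Q_mult_nth)
  also have "\<dots> = (\<Sum>i\<in>UNIV. if k = i then (\<Sum>\<alpha>\<in>?W. ?a i * (\<Sum>m\<in>UNIV. Q $ i $ m *
          (?K \<alpha> (s / p i) ** G (s / p i / p_word p \<alpha>)) $ m $ l)) else 0)"
    by (intro sum.cong) auto
  also have "\<dots> = ?a k * (\<Sum>\<alpha>\<in>?W. \<Sum>m\<in>UNIV. Q $ k $ m *
          (?K \<alpha> (s / p k) ** G (s / p k / p_word p \<alpha>)) $ m $ l)"
    by (simp add: sum_distrib_left)
  also have "\<dots> = ?a k * (\<Sum>m\<in>UNIV. Q $ k $ m * R_level c lam p Q w G (s / p k) n $ m $ l)"
    by (subst sum.swap) (simp add: R_level_def sum_distrib_left)
  finally show ?thesis .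
qed

text \<open>The functional equation is substituted into itself. Each substitution moves the argument
  from s to s / p k, so the induction runs over all s at once; the half-line above s0 is preserved
  because p k < 1.\<close>

lemma R_level_iterate:
  assumes p: "\<And>i. 0 < p i" "\<And>i. p i < 1" and "0 < s0" "s0 \<le> s"
    and F: "\<And>s k l. s0 \<le> s \<Longrightarrow> F s $ k $ l = G s $ k $ l
      + gamma_par c lam p k / (z_par c lam w k - s) * (\<Sum>m\<in>UNIV. Q $ k $ m * F (s / p k) $ m $ l)"
  shows "F s = (\<Sum>n<N. R_level c lam p Q w G s n) + R_level c lam p Q w F s N"
  using \<open>s0 \<le> s\<close>
proof (induction N arbitrary: s)
  case 0
  show ?case by simp
next
  case (Suc N)
  let ?R = "R_level c lam p Q w"
  have "F s $ k $ l = ((\<Sum>n<Suc N. ?R G s n) + ?R F s (Suc N)) $ k $ l" for k l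
  proof -
    have "s0 * p k \<le> s * 1"
      using p[of k] \<open>0 < s0\<close> Suc.prems by (intro mult_mono) auto
    then have "s0 \<le> s / p k"
      using p[of k] by (simp add: pos_le_divide_eq)
    then have "F (s / p k) = (\<Sum>n<N. ?R G (s / p k) n) + ?R F (s / p k) N"
      by (rule Suc.IH)
    then have "F s $ k $ l = G s $ k $ l + gamma_par c lam p k / (z_par c lam w k - s) *
        (\<Sum>m\<in>UNIV. Q $ k $ m * ((\<Sum>n<N. ?R G (s / p k) n $ m $ l) + ?R F (s / p k) N $ m $ l))"
      using F[OF Suc.prems, of k l] by simp
    also have "\<dots> = G s $ k $ l + (\<Sum>n<N. ?R G s (Suc n) $ k $ l) + ?R F s (Suc N) $ k $ l"
      by (simp add: R_level_Suc_nth distrib_left sum.distrib sum_distrib_left sum.swap[of _ _ "{..<N}"])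
    also have "\<dots> = ((\<Sum>n<Suc N. ?R G s n) + ?R F s (Suc N)) $ k $ l"
      by (simp only: sum.lessThan_Suc_shift) simp
    finally show ?thesis .
  qed
  then show ?case by (simp add: vec_eq_iff)
qed

text \<open>At depth k the argument has grown to at least s / r^k, so the factor A there is at most
  D r^k / s. Averaging with a row of Q adds nothing, since its entries are nonnegative with sum
  one.\<close>

lemma R_level_bound:
  assumes p: "\<And>i. 0 < p i" "\<And>i. p i \<le> r" and r: "r < 1" and "0 < s0"
    and Q: "\<And>i j. 0 \<le> Q $ i $ j" "\<And>i. (\<Sum>j\<in>UNIV. Q $ i $ j) = 1"
    and D: "0 \<le> D" "\<And>i s. s0 \<le> s \<Longrightarrow> \<bar>gamma_par c lam p i / (z_par c lam w i - s)\<bar> \<le> D / s"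
    and G: "\<And>s k l. s0 \<le> s \<Longrightarrow> \<bar>G s $ k $ l\<bar> \<le> g"
    and "s0 \<le> s"
  shows "\<bar>R_level c lam p Q w G s n $ k $ l\<bar> \<le> g * (\<Prod>k<n. D * r ^ k / s)"
  using \<open>s0 \<le> s\<close>
proof (induction n arbitrary: s k)
  case 0
  then show ?case by (simp add: G)
next
  case (Suc n)
  have g: "0 \<le> g" using G[OF Suc.prems, of k l] by linarith
  have r0: "0 < r" using p[of k] by linarith
  have s: "0 < s" using Suc.prems \<open>0 < s0\<close> by linarith
  have pk: "0 < p k" "p k \<le> r" using p by auto
  have "s0 * p k \<le> s * 1"
    using pk r \<open>0 < s0\<close> Suc.prems by (intro mult_mono) auto
  then have le: "s0 \<le> s / p k"
    using pk by (simp add: pos_le_divide_eq)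
  \<comment> \<open>The exponent is raised by one because p k \<le> r is gained from the argument s
    / p k; this leaves the place k = 0 of the product for the new factor D / s.\<close>
  let ?b = "g * (\<Prod>j<n. D * r ^ Suc j / s)"
  have b: "\<bar>R_level c lam p Q w G (s / p k) n $ m $ l\<bar> \<le> ?b" for m
  proof -
    have "\<bar>R_level c lam p Q w G (s / p k) n $ m $ l\<bar> \<le> g * (\<Prod>j<n. D * r ^ j / (s / p k))"
      by (rule Suc.IH[OF le])
    also have "\<dots> \<le> ?b"
    proof (intro mult_left_mono prod_mono conjI g)
      fix j
      show "0 \<le> D * r ^ j / (s / p k)" using D r0 s pk by simp
      have "D * r ^ j * p k \<le> D * r ^ j * r"
        using D r0 pk by (intro mult_left_mono) auto
      then show "D * r ^ j / (s / p k) \<le> D * r ^ Suc j / s"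
        using s by (simp add: divide_right_mono mult_ac)
    qed
    finally show ?thesis .
  qed
  have "\<bar>\<Sum>m\<in>UNIV. Q $ k $ m * R_level c lam p Q w G (s / p k) n $ m $ l\<bar>
      \<le> (\<Sum>m\<in>UNIV. Q $ k $ m * ?b)"
    by (rule order_trans[OF sum_abs], rule sum_mono)
       (unfold abs_mult, use Q b in \<open>auto intro!: mult_mono\<close>)
  also have "\<dots> = ?b" by (simp add: sum_distrib_right[symmetric] Q)
  finally have sum_le: "\<bar>\<Sum>m\<in>UNIV. Q $ k $ m * R_level c lam p Q w G (s / p k) n $ m $ l\<bar> \<le> ?b" .
  have "\<bar>R_level c lam p Q w G s (Suc n) $ k $ l\<bar> \<le> D / s * ?b"
    unfolding R_level_Suc_nth abs_mult
    using sum_le D(2)[OF Suc.prems, of k] D(1) s by (intro mult_mono) auto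
  also have "\<dots> = g * (\<Prod>k<Suc n. D * r ^ k / s)"
    by (simp only: prod.lessThan_Suc_shift) simp
  finally show ?case .
qed

text \<open>Uniqueness of bounded solutions: the same estimate makes the series for G converge and
  the remainder, which is a level applied to F itself, tend to zero.\<close>

lemma R_op_eqI:
  assumes p: "\<And>i. 0 < p i" "\<And>i. p i < 1" and s: "0 < s"
    and z: "\<And>i. z_par c lam w i < s"
    and Q: "\<And>i j. 0 \<le> Q $ i $ j" "\<And>i. (\<Sum>j\<in>UNIV. Q $ i $ j) = 1"
    and F: "\<And>t k l. s \<le> t \<Longrightarrow> F t $ k $ l = G t $ k $ l
      + gamma_par c lam p k / (z_par c lam w k - t) * (\<Sum>m\<in>UNIV. Q $ k $ m * F (t / p k) $ m $ l)"
    and Fb: "\<And>t k l. s \<le> t \<Longrightarrow> \<bar>F t $ k $ l\<bar> \<le> f"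
    and Gb: "\<And>t k l. s \<le> t \<Longrightarrow> \<bar>G t $ k $ l\<bar> \<le> g"
  shows "R_converges c lam p Q w G s \<and> F s = R_op c lam p Q w G s"
proof -
  let ?R = "R_level c lam p Q w"
  define r where "r = Max (range p)"
  have r: "p i \<le> r" for i by (simp add: r_def)
  have r1: "r < 1" unfolding r_def by (subst Max_less_iff) (auto simp: p)
  have r0: "0 < r" using p(1) r by (meson less_le_trans)
  \<comment> \<open>For t \<ge> s one has t / (t - z) = 1 + z / (t - z) \<le> 1 + |z| / (s - z), so
    |gamma / (z - t)| is at most a constant over t. The sum over phases makes the constant common to
    all of them.\<close>
  define D where "D = (\<Sum>i\<in>UNIV. \<bar>gamma_par c lam p i\<bar> * (1 + \<bar>z_par c lam w i\<bar> / (s - z_par c lam w i)))"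
  have D0: "0 \<le> D"
    unfolding D_def using z by (intro sum_nonneg mult_nonneg_nonneg) (auto simp: less_imp_le)
  have D: "\<bar>gamma_par c lam p i / (z_par c lam w i - t)\<bar> \<le> D / t" if "s \<le> t" for i t
  proof -
    let ?z = "z_par c lam w i"
    have t: "0 < t" "?z < t" using that s z[of i] by auto
    have "t / (t - ?z) = 1 + ?z / (t - ?z)" using t by (simp add: field_simps)
    also have "?z / (t - ?z) \<le> \<bar>?z\<bar> / (s - ?z)"
      using that z[of i] by (intro frac_le) auto
    finally have "\<bar>gamma_par c lam p i\<bar> * (t / (t - ?z)) \<le> \<bar>gamma_par c lam p i\<bar> * (1 + \<bar>?z\<bar> / (s - ?z))"
      by (intro mult_left_mono) auto
    also have "\<dots> \<le> D"
      unfolding D_def using z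
      by (intro member_le_sum[where f="\<lambda>i. \<bar>gamma_par c lam p i\<bar> * (1 + \<bar>z_par c lam w i\<bar> / (s - z_par c lam w i))"]
          mult_nonneg_nonneg add_nonneg_nonneg divide_nonneg_nonneg) (auto simp: less_imp_le)
    finally have "\<bar>gamma_par c lam p i\<bar> * (t / (t - ?z)) / t \<le> D / t"
      using t by (intro divide_right_mono) auto
    moreover have "\<bar>gamma_par c lam p i / (?z - t)\<bar> = \<bar>gamma_par c lam p i\<bar> * (t / (t - ?z)) / t"
      using t by (simp add: abs_divide)
    ultimately show ?thesis by simp
  qed
  let ?b = "\<lambda>n. \<Prod>k<n. D * r ^ k / s"
  have b0: "0 \<le> ?b n" for n using D0 r0 s by (intro prod_nonneg) auto
  \<comment> \<open>However large D / s is, the factors D r^n / s eventually stay below 1/2, which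
    is the ratio used in the test.\<close>
  have "(\<lambda>n. D / s * r ^ n) \<longlonglongrightarrow> D / s * 0"
    using r0 r1 by (intro tendsto_mult_left LIMSEQ_power_zero) auto
  then have "\<forall>\<^sub>F n in sequentially. D / s * r ^ n < 1 / 2"
    by (rule order_tendstoD) simp
  then obtain n0 where n0: "\<And>n. n0 \<le> n \<Longrightarrow> D * r ^ n / s \<le> 1 / 2"
    unfolding eventually_sequentially by (metis less_imp_le times_divide_eq_left)
  have b: "summable ?b"
  proof (rule summable_ratio_test[of "1 / 2" n0])
    show "norm (?b (Suc n)) \<le> 1 / 2 * norm (?b n)" if "n0 \<le> n" for n
      using mult_left_mono[OF n0[OF that] b0[of n]] b0 D0 r0 s
      by (simp add: abs_mult mult_ac)
  qed simp
  \<comment> \<open>Stated for a general H because it serves twice, for the terms of the series (H =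
    G) and for the remainder (H = F). The squared cardinality comes from passing from entries to the
    norm.\<close>
  have bound: "norm (?R H s n) \<le> h * real (CARD('a) * CARD('a)) * ?b n"
    if H: "\<And>t k l. s \<le> t \<Longrightarrow> \<bar>H t $ k $ l\<bar> \<le> h" for H h n
  proof -
    have "norm (?R H s n) \<le> (\<Sum>i\<in>UNIV. norm (?R H s n $ i))"
      unfolding norm_vec_def by (rule L2_set_le_sum) simp
    also have "\<dots> \<le> (\<Sum>i\<in>UNIV. \<Sum>j\<in>UNIV. \<bar>?R H s n $ i $ j\<bar>)"
      by (intro sum_mono norm_le_l1_cart)
    also have "\<dots> \<le> (\<Sum>i\<in>(UNIV::'a set). \<Sum>j\<in>(UNIV::'a set). h * ?b n)"
      by (intro sum_mono R_level_bound[where s0=s and r=r] p r r1 s Q D0 D H) (auto simp: s)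
    finally show ?thesis by (simp add: mult_ac)
  qed
  have sumG: "summable (?R G s)"
    by (rule summable_comparison_test'[OF summable_mult[OF b] bound[where H=G, OF Gb]])
  have "(\<lambda>n. ?R F s n) \<longlonglongrightarrow> 0"
  proof (rule summable_LIMSEQ_zero)
    show "summable (?R F s)"
      by (rule summable_comparison_test'[OF summable_mult[OF b] bound[where H=F, OF Fb]])
  qed
  moreover have "F s = (\<Sum>n<N. ?R G s n) + ?R F s N" for N
    by (rule R_level_iterate[where s0=s]) (use p s F in auto)
  then have "(\<Sum>n<N. ?R G s n) = F s - ?R F s N" for N
    by (simp add: algebra_simps)
  ultimately have "(\<lambda>N. \<Sum>n<N. ?R G s n) \<longlonglongrightarrow> F s - 0"
    using tendsto_diff[OF tendsto_const, of "?R F s" 0 sequentially "F s"] by simp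
  then have "?R G s sums F s" by (simp add: sums_def)
  then have "F s = (\<Sum>n. ?R G s n)" by (simp add: sums_iff)
  also have "\<dots> = ?R G s 0 + (\<Sum>n. ?R G s (Suc n))"
    using suminf_split_head[OF sumG] by simp
  finally have "F s = R_op c lam p Q w G s" by (simp add: R_op_def)
  moreover have "R_converges c lam p Q w G s"
    using sumG by (simp add: R_converges_def summable_Suc_iff)
  ultimately show ?thesis by blast
qed

section \<open>Path structure\<close>

context level_phase_process
begin

text \<open>A function of arbitrary sequences and not of paths, so that the same expression can be
  evaluated along a path and integrated over a product space of period lengths.\<close>

primrec level_seq :: "real \<Rightarrow> (nat \<Rightarrow> 'm) \<Rightarrow> (nat \<Rightarrow> real) \<Rightarrow> nat \<Rightarrow> real" where
  "level_seq x y t 0 = x"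
| "level_seq x y t (Suc n) = p (y n) * (level_seq x y t n + t n / c (y n))"

text \<open>
  The discount factor of the first $n$ periods on the event that none of them crosses the level $a$.
  The condition \<open>0 \<le> t n\<close> is void on actual paths; it keeps the level in $[0,a]$ wherever \<open>surv\<close>
  does not vanish, so that bounds hold for every sequence of period lengths and not just almost all.
\<close>

primrec surv :: "real \<Rightarrow> real \<Rightarrow> real \<Rightarrow> (nat \<Rightarrow> 'm) \<Rightarrow> (nat \<Rightarrow> real) \<Rightarrow> nat \<Rightarrow> real" where
  "surv w a x y t 0 = 1"
| "surv w a x y t (Suc n) = surv w a x y t n *
     (if 0 \<le> t n \<and> level_seq x y t n + t n / c (y n) \<le> a then exp (- w * t n) else 0)"

text \<open>
  The discount factor at the crossing time if period $n$ is the crossing one. The inequality is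
  strict: if the level would reach $a$ exactly at the end of a period, the jump prevents it.
  The maximum only matters for paths that start above $a$.
\<close>

definition cross :: "real \<Rightarrow> real \<Rightarrow> real \<Rightarrow> (nat \<Rightarrow> 'm) \<Rightarrow> (nat \<Rightarrow> real) \<Rightarrow> nat \<Rightarrow> real" where
  "cross w a x y t n = surv w a x y t n *
     (if a < level_seq x y t n + t n / c (y n)
      then exp (- w * (c (y n) * max 0 (a - level_seq x y t n))) else 0)"

lemma level_seq_cong:
  "(\<And>k. k < n \<Longrightarrow> y k = y' k) \<Longrightarrow> (\<And>k. k < n \<Longrightarrow> t k = t' k) \<Longrightarrow>
    level_seq x y t n = level_seq x y' t' n"
  by (induction n) simp_all

lemma surv_cong:
  "(\<And>k. k < n \<Longrightarrow> y k = y' k) \<Longrightarrow> (\<And>k. k < n \<Longrightarrow> t k = t' k) \<Longrightarrow>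
    surv w a x y t n = surv w a x y' t' n"
proof (induction n)
  case (Suc n)
  then have "level_seq x y t n = level_seq x y' t' n" by (intro level_seq_cong) auto
  then show ?case using Suc by simp
qed simp

lemma surv_nonneg: "0 \<le> surv w a x y t n"
  by (induction n) simp_all

lemma cross_nonneg: "0 \<le> cross w a x y t n"
  by (simp add: cross_def surv_nonneg)

text \<open>Crossing in a period and surviving it exclude each other, and either way the discount is
  at most one; hence the weight \<open>surv\<close> is passed on without increase. With these as
  sub-probability weights, the martingale inherits any bound on v over [0, a].\<close>

lemma sum_cross_add_surv_le:
  assumes "0 \<le> w"
  shows "(\<Sum>k<n. cross w a x y t k) + surv w a x y t n \<le> 1"
proof (induction n)
  case (Suc n)
  have "cross w a x y t n + surv w a x y t (Suc n) \<le> surv w a x y t n * 1"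
    unfolding cross_def surv.simps distrib_left[symmetric]
    using assms c_pos[of "y n"] by (intro mult_left_mono surv_nonneg) (auto intro!: mult_nonneg_nonneg)
  with Suc show ?case by simp
qed simp

lemma surv_le_exp:
  assumes "0 \<le> w"
  shows "surv w a x y t n \<le> exp (- w * (\<Sum>k<n. t k))"
proof (induction n)
  case (Suc n)
  have "surv w a x y t (Suc n) \<le> exp (- w * (\<Sum>k<n. t k)) * exp (- w * t n)"
    unfolding surv.simps by (intro mult_mono Suc.IH) (auto simp: surv_nonneg)
  then show ?case by (simp add: exp_add[symmetric] distrib_left)
qed simp

lemma level_seq_bounds:
  assumes "surv w a x y t n \<noteq> 0" "0 \<le> x" "x \<le> a"
  shows "0 \<le> level_seq x y t n \<and> level_seq x y t n \<le> a"
  using assms(1)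
proof (induction n)
  case (Suc n)
  let ?u = "level_seq x y t n + t n / c (y n)"
  from Suc.prems have "0 \<le> t n" "?u \<le> a" "surv w a x y t n \<noteq> 0"
    by (auto split: if_splits)
  with Suc.IH c_pos[of "y n"] have u: "0 \<le> ?u" "?u \<le> a" by auto
  have "p (y n) * ?u \<le> 1 * ?u"
    using p_bounds[of "y n"] u by (intro mult_right_mono) auto
  then show ?case using u p_bounds[of "y n"] by auto
qed (use assms in auto)

lemma borel_measurable_level_seq:
  assumes "x \<in> borel_measurable M"
    and "\<And>k. k < n \<Longrightarrow> (\<lambda>\<omega>. y \<omega> k) \<in> measurable M (count_space UNIV)"
    and "\<And>k. k < n \<Longrightarrow> (\<lambda>\<omega>. t \<omega> k) \<in> borel_measurable M"
  shows "(\<lambda>\<omega>. level_seq (x \<omega>) (y \<omega>) (t \<omega>) n) \<in> borel_measurable M"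
  using assms(2,3)
proof (induction n)
  case 0
  show ?case using assms(1) by simp
next
  case (Suc n)
  have [measurable]: "(\<lambda>\<omega>. y \<omega> n) \<in> measurable M (count_space UNIV)"
    "(\<lambda>\<omega>. t \<omega> n) \<in> borel_measurable M"
    "(\<lambda>\<omega>. level_seq (x \<omega>) (y \<omega>) (t \<omega>) n) \<in> borel_measurable M"
    using Suc by auto
  show ?case unfolding level_seq.simps by measurable
qed

lemma borel_measurable_surv:
  assumes "x \<in> borel_measurable M"
    and "\<And>k. k < n \<Longrightarrow> (\<lambda>\<omega>. y \<omega> k) \<in> measurable M (count_space UNIV)"
    and "\<And>k. k < n \<Longrightarrow> (\<lambda>\<omega>. t \<omega> k) \<in> borel_measurable M"
  shows "(\<lambda>\<omega>. surv w a (x \<omega>) (y \<omega>) (t \<omega>) n) \<in> borel_measurable M"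
  using assms(2,3)
proof (induction n)
  case (Suc n)
  have [measurable]: "(\<lambda>\<omega>. y \<omega> n) \<in> measurable M (count_space UNIV)"
    "(\<lambda>\<omega>. t \<omega> n) \<in> borel_measurable M"
    "(\<lambda>\<omega>. surv w a (x \<omega>) (y \<omega>) (t \<omega>) n) \<in> borel_measurable M"
    using Suc by auto
  have [measurable]: "(\<lambda>\<omega>. level_seq (x \<omega>) (y \<omega>) (t \<omega>) n) \<in> borel_measurable M"
    using assms(1) Suc.prems by (intro borel_measurable_level_seq) auto
  show ?case unfolding surv.simps by measurable
qed simp

lemma borel_measurable_cross:
  assumes [measurable]: "x \<in> borel_measurable M"
    "\<And>k. (\<lambda>\<omega>. y \<omega> k) \<in> measurable M (count_space UNIV)"
    "\<And>k. (\<lambda>\<omega>. t \<omega> k) \<in> borel_measurable M"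
  shows "(\<lambda>\<omega>. cross w a (x \<omega>) (y \<omega>) (t \<omega>) n) \<in> borel_measurable M"
proof -
  note [measurable] = borel_measurable_level_seq[OF assms] borel_measurable_surv[OF assms]
  show ?thesis unfolding cross_def by measurable
qed

section \<open>Crossing periods and the hitting time along a path\<close>

abbreviation phases :: "'a \<Rightarrow> nat \<Rightarrow> 'm" where "phases \<omega> \<equiv> \<lambda>n. Y n \<omega>"
abbreviation periods :: "'a \<Rightarrow> nat \<Rightarrow> real" where "periods \<omega> \<equiv> \<lambda>n. T n \<omega>"

lemma jump_time_Suc: "jump_time T (Suc n) \<omega> = jump_time T n \<omega> + T n \<omega>"
  by (simp add: jump_time_def)

lemma jump_time_mono:
  assumes "\<omega> \<in> space N" "m \<le> n"
  shows "jump_time T m \<omega> \<le> jump_time T n \<omega>"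
  unfolding jump_time_def
  using assms T_pos by (intro sum_mono2) (auto simp: less_imp_le)

lemma level_at_jump_time:
  assumes "\<omega> \<in> space N"
  shows "X (jump_time T n \<omega>) \<omega> = level_seq (X 0 \<omega>) (phases \<omega>) (periods \<omega>) n"
proof (induction n)
  case 0
  show ?case by (simp add: jump_time_def)
next
  case (Suc n)
  then show ?case using level_at_jump[OF assms] by simp
qed

lemma period_exists:
  assumes "\<omega> \<in> space N" "0 \<le> t"
  obtains n where "jump_time T n \<omega> \<le> t" "t < jump_time T (Suc n) \<omega>"
proof -
  have "\<exists>n. t < jump_time T n \<omega>"
    using no_explosion[OF assms(1)] by (auto simp: filterlim_at_top_dense eventually_sequentially)
  then obtain n where n: "t < jump_time T n \<omega>" "\<And>m. m < n \<Longrightarrow> \<not> t < jump_time T m \<omega>"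
    using exists_least_iff[of "\<lambda>n. t < jump_time T n \<omega>"] by blast
  moreover obtain m where "n = Suc m"
    using n(1) assms(2) by (cases n) (auto simp: jump_time_def)
  ultimately show thesis
    by (intro that[of m]) (auto simp: not_less)
qed

lemma surv_eq:
  assumes "\<omega> \<in> space N"
  shows "surv w a x (phases \<omega>) (periods \<omega>) n =
    (if \<forall>k<n. level_seq x (phases \<omega>) (periods \<omega>) k + T k \<omega> / c (Y k \<omega>) \<le> a
     then exp (- w * jump_time T n \<omega>) else 0)"
proof (induction n)
  case 0
  show ?case by (simp add: jump_time_def)
next
  case (Suc n)
  show ?case
    using less_imp_le[OF T_pos[OF assms, of n]]
    by (auto simp: Suc.IH less_Suc_eq jump_time_Suc exp_add[symmetric] distrib_left)
qed

context
  fixes \<omega> and a :: real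
  assumes \<omega>: "\<omega> \<in> space N"
begin

abbreviation "lev \<equiv> level_seq (X 0 \<omega>) (phases \<omega>) (periods \<omega>)"

lemma level_less_period_end:
  assumes "jump_time T n \<omega> \<le> t" "t < jump_time T (Suc n) \<omega>"
  shows "X t \<omega> < lev n + T n \<omega> / c (Y n \<omega>)"
  using level_between_jumps[OF \<omega> assms] assms c_pos[of "Y n \<omega>"]
  by (simp add: level_at_jump_time[OF \<omega>] jump_time_Suc divide_strict_right_mono)

text \<open>Earlier periods stay strictly below a, because the level at the end of a period is never
  attained. In period n the slope is 1 / c, so the missing height a - \<open>lev n\<close> takes c
  times as long, and later periods begin after \<open>\<tau>\<close>. As \<open>\<tau>\<close> lies
  before the next jump, the phase is still \<open>Y n\<close>.\<close>

lemma hitting_time_crossing: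
  assumes before: "\<And>k. k < n \<Longrightarrow> lev k + T k \<omega> / c (Y k \<omega>) \<le> a"
    and now: "a < lev n + T n \<omega> / c (Y n \<omega>)"
  defines "\<tau> \<equiv> jump_time T n \<omega> + c (Y n \<omega>) * max 0 (a - lev n)"
  shows "hitting_time_up X a \<omega> = ereal \<tau>" "J \<tau> \<omega> = Y n \<omega>"
proof -
  have c: "0 < c (Y n \<omega>)" by (rule c_pos)
  have "c (Y n \<omega>) * (a - lev n) < T n \<omega>"
    using now c by (simp add: field_simps)
  then have \<tau>: "jump_time T n \<omega> \<le> \<tau>" "\<tau> < jump_time T (Suc n) \<omega>"
    using T_pos[OF \<omega>, of n] c by (auto simp: \<tau>_def jump_time_Suc max_def)
  have "0 \<le> jump_time T n \<omega>"
    using jump_time_mono[OF \<omega>, of 0 n] by (simp add: jump_time_def)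
  moreover have "X \<tau> \<omega> = lev n + max 0 (a - lev n)"
    using level_between_jumps[OF \<omega> \<tau>] c by (simp add: \<tau>_def level_at_jump_time[OF \<omega>])
  ultimately have in_set: "\<tau> \<in> {t. 0 \<le> t \<and> a \<le> X t \<omega>}" using \<tau> by auto
  have "\<tau> \<le> t" if t: "0 \<le> t" "a \<le> X t \<omega>" for t
  proof -
    obtain k where k: "jump_time T k \<omega> \<le> t" "t < jump_time T (Suc k) \<omega>"
      using period_exists[OF \<omega> t(1)] by blast
    consider "k < n" | "k = n" | "Suc n \<le> k" by linarith
    then show ?thesis
    proof cases
      case 1
      with before[OF 1] level_less_period_end[OF k] t show ?thesis by linarith
    next
      case 2
      have "a - lev n \<le> (t - jump_time T n \<omega>) / c (Y n \<omega>)"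
        using level_between_jumps[OF \<omega> k] t 2 by (simp add: level_at_jump_time[OF \<omega>])
      moreover have "0 \<le> (t - jump_time T n \<omega>) / c (Y n \<omega>)"
        using k 2 c by simp
      ultimately have "max 0 (a - lev n) \<le> (t - jump_time T n \<omega>) / c (Y n \<omega>)" by simp
      then have "c (Y n \<omega>) * max 0 (a - lev n) \<le> c (Y n \<omega>) * ((t - jump_time T n \<omega>) / c (Y n \<omega>))"
        using c by (intro mult_left_mono) auto
      then show ?thesis using c by (simp add: \<tau>_def)
    next
      case 3
      with jump_time_mono[OF \<omega> 3] \<tau> k show ?thesis by linarith
    qed
  qed
  then show "hitting_time_up X a \<omega> = ereal \<tau>"
    unfolding hitting_time_up_def using in_set by (intro cInf_eq_minimum) auto
  show "J \<tau> \<omega> = Y n \<omega>" by (rule phase_between_jumps[OF \<omega> \<tau>])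
qed

lemma hitting_time_no_crossing:
  assumes "\<And>n. lev n + T n \<omega> / c (Y n \<omega>) \<le> a"
  shows "hitting_time_up X a \<omega> = \<infinity>"
proof -
  have "{t. 0 \<le> t \<and> a \<le> X t \<omega>} = {}"
  proof (safe, simp)
    fix t assume t: "0 \<le> t" "a \<le> X t \<omega>"
    obtain k where k: "jump_time T k \<omega> \<le> t" "t < jump_time T (Suc k) \<omega>"
      using period_exists[OF \<omega> t(1)] by blast
    from level_less_period_end[OF k] assms[of k] t show False by linarith
  qed
  then show ?thesis
    unfolding hitting_time_up_def by (simp only:) (simp add: top_ereal_def)
qed

text \<open>
  No assumption on the initial level is made here, since the limit also provides the measurability
  of the integrand of \<open>Z_up\<close> on the whole space, including the null set where \<open>X 0 \<noteq> x\<close>.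
\<close>

lemma sum_cross_tendsto:
  "(\<lambda>n. \<Sum>k<n. cross w a (X 0 \<omega>) (phases \<omega>) (periods \<omega>) k * of_bool (Y k \<omega> = j)) \<longlonglongrightarrow>
    (let \<tau> = hitting_time_up X a \<omega> in
       if \<tau> = \<infinity> then 0
       else exp (- w * real_of_ereal \<tau>) * of_bool (J (real_of_ereal \<tau>) \<omega> = j))"
proof (cases "\<exists>n. a < lev n + T n \<omega> / c (Y n \<omega>)")
  case False
  then have "hitting_time_up X a \<omega> = \<infinity>"
    by (intro hitting_time_no_crossing) (auto simp: not_less)
  with False show ?thesis by (simp add: cross_def)
next
  case True
  then obtain n where n: "a < lev n + T n \<omega> / c (Y n \<omega>)"
      "\<And>k. k < n \<Longrightarrow> lev k + T k \<omega> / c (Y k \<omega>) \<le> a"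
    using exists_least_iff[of "\<lambda>n. a < lev n + T n \<omega> / c (Y n \<omega>)"] by (auto simp: not_less)
  let ?f = "\<lambda>k. cross w a (X 0 \<omega>) (phases \<omega>) (periods \<omega>) k * of_bool (Y k \<omega> = j)"
  have zero: "?f k = 0" if "k \<noteq> n" for k
  proof (cases "k < n")
    case True
    with n(2)[OF True] show ?thesis by (simp add: cross_def)
  next
    case False
    with that have "n < k" by simp
    with n(1) have "surv w a (X 0 \<omega>) (phases \<omega>) (periods \<omega>) k = 0"
      by (auto simp: surv_eq[OF \<omega>] not_le)
    then show ?thesis by (simp add: cross_def)
  qed
  have single: "(\<lambda>N. \<Sum>k<N. f k) \<longlonglongrightarrow> f n" if "\<And>k. k \<noteq> n \<Longrightarrow> f k = 0" for f :: "nat \<Rightarrow> real"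
    using sums_finite[of "{n}" f] that by (simp add: sums_def)
  let ?\<tau> = "jump_time T n \<omega> + c (Y n \<omega>) * max 0 (a - lev n)"
  have "?f n = exp (- w * ?\<tau>) * of_bool (J ?\<tau> \<omega> = j)"
    using n hitting_time_crossing(2)[OF n(2,1)]
    by (simp add: cross_def surv_eq[OF \<omega>] exp_add[symmetric] distrib_left)
  moreover have "hitting_time_up X a \<omega> = ereal ?\<tau>"
    by (rule hitting_time_crossing(1)[OF n(2,1)])
  moreover have "(\<lambda>N. \<Sum>k<N. ?f k) \<longlonglongrightarrow> ?f n"
    by (rule single) (rule zero)
  ultimately show ?thesis by (simp add: Let_def)
qed

end

end

section \<open>The martingale along the jump chain\<close>

abbreviation exponential :: "real \<Rightarrow> real measure" where
  "exponential l \<equiv> density lborel (exponential_density l)"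

lemma has_bochner_integral_exponential_tail:
  fixes l h :: real
  assumes "0 < l"
  shows "has_bochner_integral lborel (\<lambda>t. l * exp (- l * t) * indicator {h..} t) (exp (- l * h))"
proof -
  have "((\<lambda>t. - exp (- l * t)) \<longlongrightarrow> - 0) (at_top :: real filter)"
    using assms by (intro tendsto_minus filterlim_compose[OF exp_at_bot])
      (simp add: filterlim_uminus_at_bot filterlim_tendsto_pos_mult_at_top[OF tendsto_const _ filterlim_ident])
  then have lim: "((\<lambda>t. - exp (- l * t)) \<longlongrightarrow> 0) at_top" by simp
  have "(\<integral>\<^sup>+t. ennreal (l * exp (- l * t)) * indicator {h..} t \<partial>lborel) = ennreal (0 - - exp (- l * h))"
    by (rule nn_integral_FTC_atLeast[OF _ _ _ lim])
       (use assms in \<open>auto intro!: derivative_eq_intros\<close>)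
  then have "(\<integral>\<^sup>+t. ennreal (l * exp (- l * t) * indicator {h..} t) \<partial>lborel) = ennreal (exp (- l * h))"
    by (simp add: ennreal_mult'' ennreal_indicator)
  then show ?thesis
    by (intro has_bochner_integral_nn_integral) (use assms in auto)
qed

context level_phase_process
begin

text \<open>The discounted payoff of one period entered at level L in phase i, with k as the phase
  after the jump. The value 0 for negative t matches the guard in \<open>surv\<close>, which gives
  bounds for every real t.\<close>

definition step_gain :: "real \<Rightarrow> real \<Rightarrow> ('m \<Rightarrow> real \<Rightarrow> real) \<Rightarrow> 'm \<Rightarrow> real \<Rightarrow> real \<Rightarrow> 'm \<Rightarrow> real" where
  "step_gain w a v i L t k =
    (if a < L + t / c i then exp (- w * (c i * (a - L))) * v i a
     else if 0 \<le> t then exp (- w * t) * v k (p i * (L + t / c i)) else 0)"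

text \<open>The differential equation makes -exp(-(l + w) t) v(L + t/d) a primitive of the jump
  contribution. Up to the time h at which a is reached, it yields v(L) - exp(-(l + w) h) v(a). The
  chance exp(-l h) of no jump before h supplies exactly the missing boundary term.\<close>

lemma integral_step_gain:
  assumes v: "\<And>i x. (v i has_real_derivative
      z_par c lam w i * v i x - c i * lam i * (\<Sum>k\<in>UNIV. Q $ i $ k * v k (p i * x))) (at x)"
    and L: "L \<le> a"
  shows "(\<integral>t. (\<Sum>k\<in>UNIV. Q $ i $ k * step_gain w a v i L t k) \<partial>exponential (lam i)) = v i L"
proof -
  have isCont: "isCont (v k) t" for k t
    by (rule DERIV_isCont[OF v])
  have [continuous_intros]: "continuous_on S (v k)" for S k
    by (intro continuous_at_imp_continuous_on ballI isCont)
  have [measurable]: "v k \<in> borel_measurable borel" for k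
    by (intro borel_measurable_continuous_onI continuous_intros)
  define l where "l = lam i"
  have l: "0 < l" by (simp add: l_def rate_pos)
  define d where "d = c i"
  have d: "0 < d" by (simp add: d_def c_pos)
  define h where "h = d * (a - L)"
  have h: "0 \<le> h" "L + h / d = a" using L d by (auto simp: h_def field_simps)
  define g where "g = (\<lambda>t. \<Sum>k\<in>UNIV. Q $ i $ k * v k (p i * (L + t / d)))"
  have [continuous_intros]: "continuous_on S g" for S
    unfolding g_def using d by (intro continuous_intros continuous_on_compose2[where g="v _" and t=UNIV]) auto
  have [measurable]: "g \<in> borel_measurable borel"
    by (intro borel_measurable_continuous_onI continuous_intros)
  have gain: "(\<Sum>k\<in>UNIV. Q $ i $ k * step_gain w a v i L t k)
    = (if h < t then exp (- w * h) * v i a else if 0 \<le> t then exp (- w * t) * g t else 0)" for t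
  proof -
    have "a < L + t / d \<longleftrightarrow> h < t"
      using d by (simp add: h_def field_simps)
    moreover have "(\<Sum>k\<in>UNIV. Q $ i $ k * (exp (- w * h) * v i a)) = exp (- w * h) * v i a"
      by (simp add: sum_distrib_right[symmetric] Q_row_sum)
    moreover have "(\<Sum>k\<in>UNIV. Q $ i $ k * (exp (- w * t) * v k (p i * (L + t / d)))) = exp (- w * t) * g t"
      by (simp add: g_def sum_distrib_left mult_ac)
    ultimately show ?thesis
      by (simp add: step_gain_def d_def[symmetric] h_def[symmetric])
  qed
  let ?F1 = "\<lambda>t. (l * exp (- l * t) * indicator {h..} t) * (exp (- w * h) * v i a)"
  let ?f = "\<lambda>t. l * exp (- (l + w) * t) * g t"
  let ?F = "\<lambda>t. - (exp (- (l + w) * t) * v i (L + t / d))"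
  have F1: "has_bochner_integral lborel ?F1 (exp (- l * h) * (exp (- w * h) * v i a))"
    by (intro has_bochner_integral_mult_left has_bochner_integral_exponential_tail l)
  have F2: "has_bochner_integral lborel (\<lambda>t. ?f t * indicator {0..h} t) (?F h - ?F 0)"
  proof (rule has_bochner_integral_FTC_Icc_real)
    fix t :: real
    have "((\<lambda>t. v i (L + t / d)) has_real_derivative
        (z_par c lam w i * v i (L + t / d) - d * l * g t) * (1 / d)) (at t)"
    proof (rule DERIV_chain2[where f="v i" and g="\<lambda>t. L + t / d"])
      show "(v i has_real_derivative z_par c lam w i * v i (L + t / d) - d * l * g t) (at (L + t / d))"
        using v[of i "L + t / d"] by (simp add: g_def d_def l_def)
      show "((\<lambda>t. L + t / d) has_real_derivative 1 / d) (at t)"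
        using d by (auto intro!: derivative_eq_intros)
    qed
    moreover have "(z_par c lam w i * v i (L + t / d) - d * l * g t) * (1 / d)
        = (l + w) * v i (L + t / d) - l * g t"
      using d by (simp add: z_par_def l_def[symmetric] d_def[symmetric] field_simps)
    ultimately have "((\<lambda>t. v i (L + t / d)) has_real_derivative (l + w) * v i (L + t / d) - l * g t) (at t)"
      by simp
    then show "(?F has_real_derivative ?f t) (at t)"
      by (auto intro!: derivative_eq_intros simp: algebra_simps)
    show "isCont ?f t"
      by (rule continuous_on_interior[of UNIV]) (auto intro!: continuous_intros)
  qed (rule h)
  have "(\<integral>t. (\<Sum>k\<in>UNIV. Q $ i $ k * step_gain w a v i L t k) \<partial>exponential l)
      = (\<integral>t. exponential_density l t * (if h < t then exp (- w * h) * v i a else if 0 \<le> t then exp (- w * t) * g t else 0) \<partial>lborel)"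
    unfolding gain using l by (subst integral_density) (auto intro!: AE_I2 exponential_density_nonneg)
  \<comment> \<open>Both closed intervals contain h, so the integrands differ at most at that point,
    which is a null set.\<close>
  also have "\<dots> = (\<integral>t. ?F1 t + ?f t * indicator {0..h} t \<partial>lborel)"
  proof (rule integral_cong_AE)
    show "AE t in lborel. exponential_density l t * (if h < t then exp (- w * h) * v i a
        else if 0 \<le> t then exp (- w * t) * g t else 0) = ?F1 t + ?f t * indicator {0..h} t"
      using AE_lborel_singleton[of h]
    proof eventually_elim
      case (elim t)
      then show ?case
        using h by (auto simp: exponential_density_def indicator_def exp_add[symmetric] algebra_simps)
    qed
  qed measurable
  also have "\<dots> = exp (- l * h) * (exp (- w * h) * v i a) + (?F h - ?F 0)"
    using has_bochner_integral_add[OF F1 F2] by (rule has_bochner_integral_integral_eq)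
  also have "\<dots> = v i L"
    by (simp add: h(2) exp_add[symmetric] algebra_simps mult_exp_exp)
  finally show ?thesis by (simp add: l_def)
qed

section \<open>Law of finite stretches of the jump chain\<close>

lemma sets_law: "0 \<le> x \<Longrightarrow> sets (P x i) = sets N"
  and space_law: "0 \<le> x \<Longrightarrow> space (P x i) = space N"
  and prob_space_law: "0 \<le> x \<Longrightarrow> prob_space (P x i)"
  using prob_law[of x i] by (auto simp: space_prob_algebra dest: sets_eq_imp_space_eq)

text \<open>Both sides are integrals against finite measures on the space of period lengths, and
  \<open>jump_law\<close> makes these agree on rectangles. The phases extend one index beyond the
  periods because a martingale increment looks at the phase after the last jump.\<close>

lemma word_law:
  fixes f :: "(nat \<Rightarrow> real) \<Rightarrow> real"
  assumes x: "0 \<le> x" and f: "f \<in> borel_measurable (PiM {..n} (\<lambda>_. borel))"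
  shows "(\<integral>\<omega>. of_bool (\<forall>k\<le>Suc n. Y k \<omega> = y k) * f (\<lambda>k\<in>{..n}. T k \<omega>) \<partial>P x i)
    = of_bool (y 0 = i) * (\<Prod>k<Suc n. Q $ y k $ y (Suc k))
      * (\<integral>t. f t \<partial>PiM {..n} (\<lambda>k. exponential (lam (y k))))"
proof -
  interpret prob_space "P x i" by (rule prob_space_law[OF x])
  note [simp, measurable_cong] = sets_law[OF x]
  note [measurable] = measurable_T measurable_Y f
  let ?E = "\<lambda>k. exponential (lam (y k))"
  let ?B = "PiM {..n} (\<lambda>_. borel :: real measure)"
  interpret Ek: prob_space "?E k" for k
    by (rule prob_space_exponential_density[OF rate_pos])
  interpret E: product_prob_space ?E "{..n}" ..
  interpret E: finite_product_prob_space ?E "{..n}" by standard simp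
  define W where "W = of_bool (y 0 = i) * (\<Prod>k<Suc n. Q $ y k $ y (Suc k))"
  have W: "0 \<le> W" by (auto simp: W_def Q_nonneg intro!: prod_nonneg mult_nonneg_nonneg)
  define D where "D = {\<omega> \<in> space N. \<forall>k\<le>Suc n. Y k \<omega> = y k}"
  have [measurable]: "D \<in> sets N" unfolding D_def by measurable
  let ?T = "\<lambda>\<omega>. \<lambda>k\<in>{..n}. T k \<omega>"
  have [measurable]: "?T \<in> measurable N ?B" by measurable
  have setsE: "sets (PiM {..n} ?E) = sets ?B" by (intro sets_PiM_cong) auto
  let ?M1 = "distr (density (P x i) (\<lambda>\<omega>. ennreal (indicator D \<omega>))) ?B ?T"
  let ?M2 = "density (PiM {..n} ?E) (\<lambda>_. ennreal W)"
  have "?M1 = ?M2"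
  proof (rule measure_eqI_PiM_finite[where I="{..n}" and M="\<lambda>_. borel" and A="\<lambda>_. space ?B"])
    fix S :: "nat \<Rightarrow> real set" assume S: "\<And>k. k \<in> {..n} \<Longrightarrow> S k \<in> sets borel"
    \<comment> \<open>\<open>jump_law\<close> ties phases and periods to the same index range.
      Period \<open>Suc n\<close> therefore gets the whole line, whose probability is one.\<close>
    define S' where "S' k = (if k \<le> n then S k else UNIV)" for k
    have S': "S' k \<in> sets borel" for k using S by (auto simp: S'_def)
    have pre: "?T -` Pi\<^sub>E {..n} S \<inter> space N \<in> sets N"
      using S by (intro measurable_sets[of ?T N ?B]) auto
    have "D \<inter> (?T -` Pi\<^sub>E {..n} S \<inter> space N) = {\<omega> \<in> space N. \<forall>k\<le>Suc n. Y k \<omega> = y k \<and> T k \<omega> \<in> S' k}"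
      by (auto simp: D_def S'_def PiE_iff le_Suc_eq)
    then have "emeasure ?M1 (Pi\<^sub>E {..n} S) = measure (P x i) {\<omega> \<in> space N. \<forall>k\<le>Suc n. Y k \<omega> = y k \<and> T k \<omega> \<in> S' k}"
      using S pre
      by (subst emeasure_distr)
         (auto simp: space_law[OF x] ennreal_indicator emeasure_restricted emeasure_eq_measure)
    also have "\<dots> = ennreal (W * (\<Prod>k\<le>Suc n. measure (?E k) (S' k)))"
      by (simp only: jump_law[OF x S'] W_def)
    also have "(\<Prod>k\<le>Suc n. measure (?E k) (S' k)) = (\<Prod>k\<le>n. measure (?E k) (S k))"
      using Ek.prob_space[of "Suc n"] by (simp add: S'_def)
    also have "ennreal (W * \<dots>) = ennreal W * (\<Prod>k\<le>n. emeasure (?E k) (S k))"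
      using W by (simp add: ennreal_mult prod_nonneg prod_ennreal[symmetric] Ek.emeasure_eq_measure)
    also have "\<dots> = emeasure ?M2 (Pi\<^sub>E {..n} S)"
      using S E.measure_times[of S]
      by (subst emeasure_density_const) (auto simp: setsE)
    finally show "emeasure ?M1 (Pi\<^sub>E {..n} S) = emeasure ?M2 (Pi\<^sub>E {..n} S)" .
  next
    show "range (\<lambda>_. space ?B) \<subseteq> prod_algebra {..n} (\<lambda>_. borel :: real measure)"
      by (auto simp: space_PiM intro!: prod_algebraI_finite)
    show "emeasure ?M1 (space ?B) \<noteq> \<infinity>"
      by (subst emeasure_distr)
         (auto simp: space_law[OF x] ennreal_indicator emeasure_restricted emeasure_eq_measure)
  qed (auto simp: setsE)
  then have "(\<integral>t. f t \<partial>?M1) = (\<integral>t. f t \<partial>?M2)" by simp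
  also have "(\<integral>t. f t \<partial>?M2) = W * (\<integral>t. f t \<partial>PiM {..n} ?E)"
    using W f by (subst integral_density) (auto simp: measurable_cong_sets[OF setsE refl])
  also have "(\<integral>t. f t \<partial>?M1) = (\<integral>\<omega>. indicator D \<omega> * f (?T \<omega>) \<partial>P x i)"
    by (subst integral_distr; (subst integral_density)?; simp)
  also have "\<dots> = (\<integral>\<omega>. of_bool (\<forall>k\<le>Suc n. Y k \<omega> = y k) * f (?T \<omega>) \<partial>P x i)"
    by (intro Bochner_Integration.integral_cong) (auto simp: D_def indicator_def space_law[OF x])
  finally show ?thesis by (simp add: W_def)
qed

text \<open>Words are taken as extensional functions on {..n}: there are finitely many, and exactly
  one agrees with a given path.\<close>

lemma integral_split_words:
  fixes f :: "'a \<Rightarrow> real"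
  assumes x: "0 \<le> x" and f: "integrable (P x i) f"
  shows "(\<integral>\<omega>. f \<omega> \<partial>P x i)
    = (\<Sum>y\<in>Pi\<^sub>E {..n} (\<lambda>_. UNIV). \<integral>\<omega>. of_bool (\<forall>k\<le>n. Y k \<omega> = y k) * f \<omega> \<partial>P x i)"
proof -
  note [measurable_cong] = sets_law[OF x]
  note [measurable] = measurable_Y
  have "(\<Sum>y\<in>Pi\<^sub>E {..n} (\<lambda>_. UNIV). of_bool (\<forall>k\<le>n. Y k \<omega> = y k) * f \<omega>) = f \<omega>" for \<omega>
  proof -
    define r where "r = restrict (\<lambda>k. Y k \<omega>) {..n}"
    have eq: "(\<forall>k\<le>n. Y k \<omega> = y k) \<longleftrightarrow> y = r" if "y \<in> Pi\<^sub>E {..n} (\<lambda>_. UNIV)" for y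
    proof
      assume "\<forall>k\<le>n. Y k \<omega> = y k"
      then show "y = r" by (intro PiE_ext[OF that]) (auto simp: r_def)
    qed (simp add: r_def)
    have "(\<Sum>y\<in>Pi\<^sub>E {..n} (\<lambda>_. UNIV). of_bool (\<forall>k\<le>n. Y k \<omega> = y k) * f \<omega>)
        = (\<Sum>y\<in>Pi\<^sub>E {..n} (\<lambda>_. UNIV). if y = r then f \<omega> else 0)"
      by (intro sum.cong refl) (simp only: eq, simp)
    also have "\<dots> = f \<omega>"
      by (simp add: sum.delta finite_PiE r_def)
    finally show ?thesis .
  qed
  then have "(\<integral>\<omega>. f \<omega> \<partial>P x i)
    = (\<integral>\<omega>. (\<Sum>y\<in>Pi\<^sub>E {..n} (\<lambda>_. UNIV). of_bool (\<forall>k\<le>n. Y k \<omega> = y k) * f \<omega>) \<partial>P x i)"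
    by simp
  also have "\<dots> = (\<Sum>y\<in>Pi\<^sub>E {..n} (\<lambda>_. UNIV). \<integral>\<omega>. of_bool (\<forall>k\<le>n. Y k \<omega> = y k) * f \<omega> \<partial>P x i)"
  proof (rule Bochner_Integration.integral_sum)
    fix y
    show "integrable (P x i) (\<lambda>\<omega>. of_bool (\<forall>k\<le>n. Y k \<omega> = y k) * f \<omega>)"
    proof (rule Bochner_Integration.integrable_bound[OF f])
      show "(\<lambda>\<omega>. of_bool (\<forall>k\<le>n. Y k \<omega> = y k) * f \<omega>) \<in> borel_measurable (P x i)"
        using borel_measurable_integrable[OF f] by measurable
    qed auto
  qed
  finally show ?thesis .
qed

lemma AE_initial_phase:
  assumes x: "0 \<le> x"
  shows "AE \<omega> in P x i. Y 0 \<omega> = i"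
proof -
  interpret prob_space "P x i" by (rule prob_space_law[OF x])
  note [measurable_cong] = sets_law[OF x]
  note [measurable] = measurable_Y
  interpret E: prob_space "exponential (lam i)"
    by (rule prob_space_exponential_density[OF rate_pos])
  have "prob {\<omega> \<in> space (P x i). Y 0 \<omega> = i} = 1"
    using jump_law[OF x, of "\<lambda>_. UNIV" i 0 "\<lambda>_. i"] E.prob_space by (simp add: space_law[OF x])
  then show ?thesis
    by (subst (asm) prob_Collect_eq_1) measurable
qed

section \<open>The bounded martingale attached to a solution v, and its limit\<close>

context
  fixes w a :: real and v :: "'m \<Rightarrow> real \<Rightarrow> real"
  assumes w: "0 < w" and a: "0 \<le> a"
    and v: "\<And>i x. (v i has_real_derivative
      z_par c lam w i * v i x - c i * lam i * (\<Sum>k\<in>UNIV. Q $ i $ k * v k (p i * x))) (at x)"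
begin

definition mart :: "real \<Rightarrow> (nat \<Rightarrow> 'm) \<Rightarrow> (nat \<Rightarrow> real) \<Rightarrow> nat \<Rightarrow> real" where
  "mart x y t n = (\<Sum>k<n. cross w a x y t k * v (y k) a)
    + surv w a x y t n * v (y n) (level_seq x y t n)"

text \<open>If the weight \<open>surv\<close> vanishes, both sides do. Otherwise the level is at
  most a, so \<open>max 0\<close> in \<open>cross\<close> agrees with the plain difference in
  \<open>step_gain\<close>. The weight depends only on periods before n, which lets period n be
  integrated separately.\<close>

lemma mart_Suc_diff:
  assumes "0 \<le> x" "x \<le> a"
  shows "mart x y t (Suc n) - mart x y t n = surv w a x y t n *
    (step_gain w a v (y n) (level_seq x y t n) (t n) (y (Suc n)) - v (y n) (level_seq x y t n))"
proof (cases "surv w a x y t n = 0")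
  case True
  then show ?thesis by (simp add: mart_def cross_def)
next
  case False
  then have "level_seq x y t n \<le> a" using level_seq_bounds assms by blast
  then show ?thesis
    by (simp add: mart_def cross_def step_gain_def algebra_simps)
qed

lemma v_bounded: "\<exists>K. \<forall>i. \<forall>u\<in>{0..a}. \<bar>v i u\<bar> \<le> K"
proof -
  have "isCont (v i) t" for i t
    by (rule DERIV_isCont[OF v])
  then have "bounded (v i ` {0..a})" for i
    by (intro compact_imp_bounded compact_continuous_image continuous_at_imp_continuous_on) auto
  then have "\<exists>K. \<forall>u\<in>{0..a}. \<bar>v i u\<bar> \<le> K" for i
    by (auto simp: bounded_iff)
  then obtain K where K: "\<And>i u. u \<in> {0..a} \<Longrightarrow> \<bar>v i u\<bar> \<le> K i" by metis
  have "\<bar>v i u\<bar> \<le> Max (range K)" if "u \<in> {0..a}" for i u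
    using K[OF that, of i] by (rule order_trans) auto
  then show ?thesis by blast
qed

lemma bound_nonneg:
  assumes "\<forall>i. \<forall>u\<in>{0..a}. \<bar>v i u\<bar> \<le> K"
  shows "0 \<le> K"
proof -
  have "\<bar>v undefined 0\<bar> \<le> K" using assms a by auto
  then show ?thesis by linarith
qed

lemma step_gain_bounded:
  assumes K: "\<forall>i. \<forall>u\<in>{0..a}. \<bar>v i u\<bar> \<le> K" and L: "0 \<le> L" "L \<le> a"
  shows "\<bar>step_gain w a v i L t k\<bar> \<le> K"
proof -
  have K0: "0 \<le> K" using bound_nonneg[OF K] .
  have c: "0 < c i" "0 < p i" "p i < 1" by (auto simp: c_pos p_bounds)
  consider "a < L + t / c i" | "\<not> a < L + t / c i" "0 \<le> t" | "\<not> a < L + t / c i" "t < 0" by linarith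
  then show ?thesis
  proof cases
    case 1
    have "exp (- w * (c i * (a - L))) * \<bar>v i a\<bar> \<le> 1 * K"
      using K a w L c by (intro mult_mono) auto
    with 1 show ?thesis by (simp add: step_gain_def abs_mult)
  next
    case 2
    then have u: "0 \<le> L + t / c i" "L + t / c i \<le> a" using L c by auto
    then have "p i * (L + t / c i) \<le> 1 * a" using c by (intro mult_mono) auto
    then have "exp (- w * t) * \<bar>v k (p i * (L + t / c i))\<bar> \<le> 1 * K"
      using u c w 2 K by (intro mult_mono) auto
    with 2 show ?thesis by (simp add: step_gain_def abs_mult)
  next
    case 3
    then show ?thesis by (simp add: step_gain_def K0)
  qed
qed

lemma surv_le_1: "surv w a x y t n \<le> 1"
  using sum_cross_add_surv_le[of w a x y t n] w
    sum_nonneg[of "{..<n}" "cross w a x y t"] by (simp add: cross_nonneg)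

lemma mart_bounded:
  assumes K: "\<forall>i. \<forall>u\<in>{0..a}. \<bar>v i u\<bar> \<le> K" and x: "0 \<le> x" "x \<le> a"
  shows "\<bar>mart x y t n\<bar> \<le> K"
proof -
  have K0: "0 \<le> K" using bound_nonneg[OF K] .
  have "\<bar>mart x y t n\<bar> \<le> \<bar>\<Sum>k<n. cross w a x y t k * v (y k) a\<bar>
      + \<bar>surv w a x y t n * v (y n) (level_seq x y t n)\<bar>"
    unfolding mart_def by (rule abs_triangle_ineq)
  also have "\<dots> \<le> (\<Sum>k<n. cross w a x y t k * K) + surv w a x y t n * K"
  proof (rule add_mono)
    show "\<bar>\<Sum>k<n. cross w a x y t k * v (y k) a\<bar> \<le> (\<Sum>k<n. cross w a x y t k * K)"
      by (rule order_trans[OF sum_abs], rule sum_mono)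
         (use K a in \<open>auto simp: abs_mult cross_nonneg intro!: mult_left_mono\<close>)
    show "\<bar>surv w a x y t n * v (y n) (level_seq x y t n)\<bar> \<le> surv w a x y t n * K"
      using level_seq_bounds[of w a x y t n] x
      by (cases "surv w a x y t n = 0") (use K in \<open>auto simp: abs_mult surv_nonneg intro!: mult_left_mono\<close>)
  qed
  also have "\<dots> = ((\<Sum>k<n. cross w a x y t k) + surv w a x y t n) * K"
    by (simp add: sum_distrib_right distrib_right)
  also have "\<dots> \<le> 1 * K"
    using sum_cross_add_surv_le[of w a x y t n] w K0 by (intro mult_right_mono) auto
  finally show ?thesis by simp
qed

lemma borel_measurable_v_phase [measurable]:
  assumes "y \<in> measurable M (count_space UNIV)" "g \<in> borel_measurable M"
  shows "(\<lambda>\<omega>. v (y \<omega>) (g \<omega>)) \<in> borel_measurable M"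
proof -
  have "isCont (v i) t" for i t
    by (rule DERIV_isCont[OF v])
  then have "v i \<in> borel_measurable borel" for i
    by (intro borel_measurable_continuous_onI continuous_at_imp_continuous_on) auto
  then have "(\<lambda>\<omega>. v i (g \<omega>)) \<in> borel_measurable M" for i
    using assms(2) by (rule measurable_compose[rotated])
  then show ?thesis
    by (rule measurable_compose_countable'[OF _ assms(1)]) (simp add: countable_finite)
qed

lemma borel_measurable_step_gain [measurable]:
  assumes [measurable]: "L \<in> borel_measurable M" "t \<in> borel_measurable M"
  shows "(\<lambda>\<omega>. step_gain w a v i (L \<omega>) (t \<omega>) k) \<in> borel_measurable M"
  unfolding step_gain_def by measurable

lemma borel_measurable_mart:
  assumes [measurable]: "\<And>k. (\<lambda>\<omega>. y \<omega> k) \<in> measurable M (count_space UNIV)"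
    "\<And>k. (\<lambda>\<omega>. t \<omega> k) \<in> borel_measurable M"
  shows "(\<lambda>\<omega>. mart x (y \<omega>) (t \<omega>) n) \<in> borel_measurable M"
proof -
  note [measurable] = borel_measurable_level_seq[OF _ assms] borel_measurable_surv[OF _ assms]
    borel_measurable_cross[OF _ assms]
  show ?thesis unfolding mart_def by measurable
qed

text \<open>The martingale property without conditional expectations: the indicator of a phase word
  takes the place of conditioning on the phases, and integrating period n with the earlier ones held
  fixed takes the place of conditioning on the periods.\<close>

lemma integral_mart_diff_word:
  assumes x: "0 \<le> x" "x \<le> a"
  shows "(\<integral>\<omega>. of_bool (\<forall>k\<le>n. Y k \<omega> = y k) *
    (mart x (phases \<omega>) (periods \<omega>) (Suc n) - mart x (phases \<omega>) (periods \<omega>) n) \<partial>P x i) = 0"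
proof -
  interpret prob_space "P x i" by (rule prob_space_law[OF x(1)])
  note [measurable_cong] = sets_law[OF x(1)]
  note [measurable] = measurable_T measurable_Y
  obtain K where K: "\<forall>i. \<forall>u\<in>{0..a}. \<bar>v i u\<bar> \<le> K" using v_bounded by blast
  have K0: "0 \<le> K" using bound_nonneg[OF K] .
  let ?E = "\<lambda>k. exponential (lam (y k))"
  interpret Ek: prob_space "?E k" for k
    by (rule prob_space_exponential_density[OF rate_pos])
  interpret E: product_prob_space ?E "{..n}" ..
  let ?B = "PiM {..n} (\<lambda>_. borel :: real measure)"
  have setsE: "sets (PiM {..n} ?E) = sets ?B" by (intro sets_PiM_cong) auto
  note [measurable_cong] = setsE
  let ?L = "\<lambda>t. level_seq x y t n" and ?S = "\<lambda>t. surv w a x y t n"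
  define f where "f j t = ?S t * (step_gain w a v (y n) (?L t) (t n) j - v (y n) (?L t))" for j t
  have coord: "(\<lambda>t. t k) \<in> borel_measurable ?B" if "k \<le> n" for k
    using that by (intro measurable_component_singleton) auto
  have [measurable]: "?L \<in> borel_measurable ?B" "?S \<in> borel_measurable ?B" "(\<lambda>t. t n) \<in> borel_measurable ?B"
    using borel_measurable_level_seq[of "\<lambda>_. x" ?B n "\<lambda>_. y" "\<lambda>t. t"]
      borel_measurable_surv[of "\<lambda>_. x" ?B n "\<lambda>_. y" "\<lambda>t. t"] coord by auto
  have f_meas [measurable]: "f j \<in> borel_measurable ?B" for j
    unfolding f_def by measurable
  have f_le: "\<bar>f j t\<bar> \<le> 2 * K" for j t
  proof (cases "?S t = 0")
    case False
    from level_seq_bounds[OF False x] have L: "0 \<le> ?L t" "?L t \<le> a" by auto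
    have "\<bar>step_gain w a v (y n) (?L t) (t n) j - v (y n) (?L t)\<bar> \<le> 2 * K"
      using step_gain_bounded[OF K L, of "y n" "t n" j] bspec[OF spec[OF K, of "y n"], of "?L t"] L
      by (simp add: abs_le_iff)
    with surv_le_1[of x y t n] surv_nonneg[of w a x y t n]
    have "?S t * \<bar>step_gain w a v (y n) (?L t) (t n) j - v (y n) (?L t)\<bar> \<le> 1 * (2 * K)"
      by (intro mult_mono) auto
    then show ?thesis by (simp add: f_def abs_mult surv_nonneg)
  qed (simp add: f_def K0)
  let ?T = "\<lambda>\<omega>. \<lambda>k\<in>{..n}. T k \<omega>"
  have [measurable]: "?T \<in> measurable N ?B" by measurable
  \<comment> \<open>The increment also depends on the next phase, so the event is split according to
    its value j; each piece fixes a full word of the kind covered by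
    \<open>word_law\<close>.\<close>
  define D :: "'m \<Rightarrow> 'a \<Rightarrow> real" where
    "D j \<omega> = of_bool (\<forall>k\<le>Suc n. Y k \<omega> = (y(Suc n := j)) k)" for j \<omega>
  have D_eq: "D j \<omega> = of_bool ((\<forall>k\<le>n. Y k \<omega> = y k) \<and> j = Y (Suc n) \<omega>)" for j \<omega>
    by (auto simp: D_def le_Suc_eq)
  have [measurable]: "D j \<in> borel_measurable N" for j
    unfolding D_def by measurable
  have split: "of_bool (\<forall>k\<le>n. Y k \<omega> = y k) *
      (mart x (phases \<omega>) (periods \<omega>) (Suc n) - mart x (phases \<omega>) (periods \<omega>) n)
      = (\<Sum>j\<in>UNIV. D j \<omega> * f j (?T \<omega>))" for \<omega>
  proof (cases "\<forall>k\<le>n. Y k \<omega> = y k")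
    case True
    have eq: "level_seq x (phases \<omega>) (periods \<omega>) n = ?L (?T \<omega>)"
      "surv w a x (phases \<omega>) (periods \<omega>) n = ?S (?T \<omega>)"
      using True by (auto intro!: level_seq_cong surv_cong)
    have "(\<Sum>j\<in>UNIV. D j \<omega> * f j (?T \<omega>)) = (\<Sum>j\<in>UNIV. if j = Y (Suc n) \<omega> then f j (?T \<omega>) else 0)"
      by (intro sum.cong) (auto simp: D_eq True)
    also have "\<dots> = f (Y (Suc n) \<omega>) (?T \<omega>)" by simp
    also have "\<dots> = mart x (phases \<omega>) (periods \<omega>) (Suc n) - mart x (phases \<omega>) (periods \<omega>) n"
      unfolding mart_Suc_diff[OF x] eq f_def using True by simp
    finally show ?thesis using True by simp
  next
    case False
    then have "D j \<omega> = 0" for j by (simp add: D_eq)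
    with False show ?thesis by simp
  qed
  define W where "W = of_bool (y 0 = i) * (\<Prod>k<n. Q $ y k $ y (Suc k))"
  have law: "(\<integral>\<omega>. D j \<omega> * f j (?T \<omega>) \<partial>P x i) = W * (Q $ y n $ j * (\<integral>t. f j t \<partial>PiM {..n} ?E))" for j
  proof -
    have "PiM {..n} (\<lambda>k. exponential (lam ((y(Suc n := j)) k))) = PiM {..n} ?E"
      by (intro PiM_cong) auto
    moreover have "(\<Prod>k<Suc n. Q $ (y(Suc n := j)) k $ (y(Suc n := j)) (Suc k)) = (\<Prod>k<n. Q $ y k $ y (Suc k)) * Q $ y n $ j"
      by simp
    ultimately show ?thesis
      using word_law[OF x(1) f_meas, where i=i and y="y(Suc n := j)", folded D_def]
      by (simp only: W_def fun_upd_other[of 0 "Suc n"] mult.assoc nat.distinct not_False_eq_True)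
  qed
  have int_f: "integrable (PiM {..n} ?E) (f j)" for j
    by (rule E.P.integrable_const_bound[of _ "2 * K"]) (auto simp: f_le)
  \<comment> \<open>Changing coordinate n leaves \<open>surv\<close> and \<open>level_seq\<close> at
    n unchanged. The inner integral is therefore that weight times the expected one-step gain minus
    v at the current level, and the two cancel by \<open>integral_step_gain\<close>.\<close>
  have inner: "(\<integral>s. (\<Sum>j\<in>UNIV. Q $ y n $ j * f j (t(n := s))) \<partial>?E n) = 0" for t
  proof (cases "?S t = 0")
    case True
    have "?S (t(n := s)) = 0" for s using True surv_cong[of n y y "t(n := s)" t w a x] by simp
    then show ?thesis by (simp add: f_def)
  next
    case False
    from level_seq_bounds[OF False x] have L: "0 \<le> ?L t" "?L t \<le> a" by auto
    let ?g = "\<lambda>s. \<Sum>j\<in>UNIV. Q $ y n $ j * step_gain w a v (y n) (?L t) s j"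
    have "?S (t(n := s)) = ?S t" "?L (t(n := s)) = ?L t" for s
      by (auto intro!: surv_cong level_seq_cong)
    then have "(\<Sum>j\<in>UNIV. Q $ y n $ j * f j (t(n := s))) = ?S t * (?g s - v (y n) (?L t))" for s
      by (simp add: f_def sum_distrib_left sum_distrib_right[symmetric] Q_row_sum algebra_simps
          sum_subtractf)
    moreover have "integrable (?E n) ?g"
      by (intro Bochner_Integration.integrable_sum integrable_mult_right
          Ek.integrable_const_bound[of _ K]) (auto simp: step_gain_bounded[OF K L])
    ultimately show ?thesis
      using integral_step_gain[OF v L(2), of "y n"] Ek.prob_space[of n]
      by simp
  qed
  have "(\<integral>\<omega>. (\<Sum>j\<in>UNIV. D j \<omega> * f j (?T \<omega>)) \<partial>P x i) = (\<Sum>j\<in>UNIV. \<integral>\<omega>. D j \<omega> * f j (?T \<omega>) \<partial>P x i)"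
  proof (rule Bochner_Integration.integral_sum, rule integrable_const_bound[of _ "2 * K"])
    show "AE \<omega> in P x i. norm (D j \<omega> * f j (?T \<omega>)) \<le> 2 * K" for j
      using f_le K0 by (intro AE_I2) (simp add: D_eq)
    show "(\<lambda>\<omega>. D j \<omega> * f j (?T \<omega>)) \<in> borel_measurable (P x i)" for j
      by measurable
  qed
  also have "\<dots> = W * (\<Sum>j\<in>UNIV. Q $ y n $ j * (\<integral>t. f j t \<partial>PiM {..n} ?E))"
    by (simp add: law sum_distrib_left)
  also have "(\<Sum>j\<in>UNIV. Q $ y n $ j * (\<integral>t. f j t \<partial>PiM {..n} ?E))
      = (\<integral>t. (\<Sum>j\<in>UNIV. Q $ y n $ j * f j t) \<partial>PiM {..n} ?E)"
    using int_f by simp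
  also have "\<dots> = (\<integral>t. (\<integral>s. (\<Sum>j\<in>UNIV. Q $ y n $ j * f j (t(n := s))) \<partial>?E n) \<partial>PiM {..<n} ?E)"
    unfolding lessThan_Suc_atMost[symmetric] lessThan_Suc
    by (rule E.product_integral_insert) (use int_f in \<open>auto simp: lessThan_Suc_atMost[symmetric] lessThan_Suc\<close>)
  also have "\<dots> = 0" by (simp add: inner)
  finally show ?thesis by (simp only: split mult_zero_right)
qed

lemma expectation_mart:
  assumes x: "0 \<le> x" "x \<le> a"
  shows "(\<integral>\<omega>. mart x (phases \<omega>) (periods \<omega>) n \<partial>P x i) = v i x"
proof -
  interpret prob_space "P x i" by (rule prob_space_law[OF x(1)])
  note [measurable_cong] = sets_law[OF x(1)]
  note [measurable] = measurable_T measurable_Y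
  have [measurable]: "(\<lambda>\<omega>. mart x (phases \<omega>) (periods \<omega>) n) \<in> borel_measurable N" for n
    by (intro borel_measurable_mart) measurable
  obtain K where K: "\<forall>i. \<forall>u\<in>{0..a}. \<bar>v i u\<bar> \<le> K" using v_bounded by blast
  have int: "integrable (P x i) (\<lambda>\<omega>. mart x (phases \<omega>) (periods \<omega>) n)" for n
    by (rule integrable_const_bound[of _ K]) (auto simp: mart_bounded[OF K x])
  show ?thesis
  proof (induction n)
    case 0
    have "(\<integral>\<omega>. mart x (phases \<omega>) (periods \<omega>) 0 \<partial>P x i) = (\<integral>\<omega>. v i x \<partial>P x i)"
      by (intro integral_cong_AE) (use AE_initial_phase[OF x(1), of i] in \<open>auto simp: mart_def\<close>)
    then show ?case by (simp add: prob_space)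
  next
    case (Suc n)
    have "(\<integral>\<omega>. mart x (phases \<omega>) (periods \<omega>) (Suc n) - mart x (phases \<omega>) (periods \<omega>) n \<partial>P x i) = 0"
      by (subst integral_split_words[where n=n, OF x(1)])
         (use int in \<open>auto simp only: Bochner_Integration.integrable_diff integral_mart_diff_word[OF x] sum.neutral_const\<close>)
    then show ?case using int Suc by simp
  qed
qed

lemma Z_up_solution:
  assumes x: "0 \<le> x" "x \<le> a"
  shows "(\<Sum>j\<in>UNIV. Z_up P X J w x a $ i $ j * v j a) = v i x"
proof -
  interpret prob_space "P x i" by (rule prob_space_law[OF x(1)])
  note [measurable_cong] = sets_law[OF x(1)]
  note [measurable] = measurable_T measurable_Y measurable_X0
  have [measurable]: "(\<lambda>\<omega>. mart x (phases \<omega>) (periods \<omega>) n) \<in> borel_measurable N" for n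
    by (intro borel_measurable_mart) measurable
  have [measurable]: "(\<lambda>\<omega>. cross w a (X 0 \<omega>) (phases \<omega>) (periods \<omega>) n) \<in> borel_measurable N" for n
    by (intro borel_measurable_cross) measurable
  obtain K where K: "\<forall>i. \<forall>u\<in>{0..a}. \<bar>v i u\<bar> \<le> K" using v_bounded by blast
  define h where "h j \<omega> = (let \<tau> = hitting_time_up X a \<omega> in if \<tau> = \<infinity> then 0
       else exp (- w * real_of_ereal \<tau>) * of_bool (J (real_of_ereal \<tau>) \<omega> = j))" for j \<omega>
  let ?s = "\<lambda>j \<omega> n. \<Sum>k<n. cross w a (X 0 \<omega>) (phases \<omega>) (periods \<omega>) k * of_bool (Y k \<omega> = j)"
  have lim: "?s j \<omega> \<longlonglongrightarrow> h j \<omega>" if "\<omega> \<in> space N" for j \<omega>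
    unfolding h_def by (rule sum_cross_tendsto[OF that])
  have [measurable]: "h j \<in> borel_measurable N" for j
    by (rule borel_measurable_LIMSEQ_real[OF lim]) measurable
  have s01: "?s j \<omega> n \<in> {0..1}" for j \<omega> n
  proof -
    have "?s j \<omega> n \<le> (\<Sum>k<n. cross w a (X 0 \<omega>) (phases \<omega>) (periods \<omega>) k)"
      by (intro sum_mono) (auto simp: cross_nonneg)
    also have "\<dots> \<le> 1"
      using sum_cross_add_surv_le[of w a "X 0 \<omega>" "phases \<omega>" "periods \<omega>" n] w
        surv_nonneg[of w a "X 0 \<omega>" "phases \<omega>" "periods \<omega>" n] by simp
    finally show ?thesis by (simp add: sum_nonneg cross_nonneg)
  qed
  have h01: "h j \<omega> \<in> {0..1}" if "\<omega> \<in> space N" for j \<omega>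
    by (rule closed_sequentially[OF _ _ lim[OF that]]) (use s01 in auto)
  have int_h: "integrable (P x i) (h j)" for j
    by (rule integrable_const_bound[of _ 1]) (use h01 in \<open>auto simp: space_law[OF x(1)]\<close>)
  \<comment> \<open>The martingale starts from the constant x while the crossing sums start from
    \<open>X 0\<close>. They are compared only where the two agree, which is almost
    everywhere.\<close>
  have lim_mart: "(\<lambda>n. mart x (phases \<omega>) (periods \<omega>) n) \<longlonglongrightarrow> (\<Sum>j\<in>UNIV. h j \<omega> * v j a)"
    if \<omega>: "\<omega> \<in> space N" and X0: "X 0 \<omega> = x" for \<omega>
  proof -
    let ?r = "\<lambda>n. surv w a x (phases \<omega>) (periods \<omega>) n * v (Y n \<omega>) (level_seq x (phases \<omega>) (periods \<omega>) n)"
    have "(\<lambda>n. \<Sum>j\<in>UNIV. ?s j \<omega> n * v j a) \<longlonglongrightarrow> (\<Sum>j\<in>UNIV. h j \<omega> * v j a)"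
      by (intro tendsto_intros lim[OF \<omega>])
    moreover have "(\<Sum>j\<in>UNIV. ?s j \<omega> n * v j a) = (\<Sum>k<n. cross w a x (phases \<omega>) (periods \<omega>) k * v (Y k \<omega>) a)" for n
    proof -
      have "(\<Sum>j\<in>UNIV. ?s j \<omega> n * v j a) = (\<Sum>k<n. \<Sum>j\<in>UNIV. cross w a x (phases \<omega>) (periods \<omega>) k * of_bool (Y k \<omega> = j) * v j a)"
        unfolding sum_distrib_right X0 by (rule sum.swap)
      also have "\<dots> = (\<Sum>k<n. \<Sum>j\<in>UNIV. if j = Y k \<omega> then cross w a x (phases \<omega>) (periods \<omega>) k * v j a else 0)"
        by (intro sum.cong) auto
      finally show ?thesis by simp
    qed
    \<comment> \<open>This covers the paths that never cross a: there \<open>surv\<close> never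
      vanishes, but jump times tend to infinity and w > 0.\<close>
    moreover have "?r \<longlonglongrightarrow> 0"
    proof (rule Lim_null_comparison)
      have "norm (?r n) \<le> exp (- w * jump_time T n \<omega>) * K" for n
      proof (cases "surv w a x (phases \<omega>) (periods \<omega>) n = 0")
        case True
        then show ?thesis using bound_nonneg[OF K] by simp
      next
        case False
        from level_seq_bounds[OF False x] show ?thesis
          unfolding real_norm_def abs_mult abs_of_nonneg[OF surv_nonneg]
          using surv_le_exp[of w a x "phases \<omega>" "periods \<omega>" n] w K
          by (intro mult_mono) (auto simp: jump_time_def)
      qed
      then show "\<forall>\<^sub>F n in sequentially. norm (?r n) \<le> exp (- w * jump_time T n \<omega>) * K" by simp
      have "filterlim (\<lambda>n. - w * jump_time T n \<omega>) at_bot sequentially"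
        using w no_explosion[OF \<omega>]
        by (simp add: filterlim_uminus_at_bot filterlim_tendsto_pos_mult_at_top[OF tendsto_const])
      then show "(\<lambda>n. exp (- w * jump_time T n \<omega>) * K) \<longlonglongrightarrow> 0"
        by (intro tendsto_mult_left_zero filterlim_compose[OF exp_at_bot])
    qed
    ultimately show ?thesis
      unfolding mart_def using tendsto_add by fastforce
  qed
  have "(\<lambda>n. \<integral>\<omega>. mart x (phases \<omega>) (periods \<omega>) n \<partial>P x i) \<longlonglongrightarrow> (\<integral>\<omega>. (\<Sum>j\<in>UNIV. h j \<omega> * v j a) \<partial>P x i)"
  proof (rule integral_dominated_convergence[where w="\<lambda>_. K"])
    show "AE \<omega> in P x i. (\<lambda>n. mart x (phases \<omega>) (periods \<omega>) n) \<longlonglongrightarrow> (\<Sum>j\<in>UNIV. h j \<omega> * v j a)"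
      using start_level[OF x(1), of i] AE_space
      by eventually_elim (rule lim_mart, simp_all add: space_law[OF x(1)])
    show "AE \<omega> in P x i. norm (mart x (phases \<omega>) (periods \<omega>) n) \<le> K" for n
      by (simp add: mart_bounded[OF K x])
  qed auto
  moreover have "(\<integral>\<omega>. (\<Sum>j\<in>UNIV. h j \<omega> * v j a) \<partial>P x i) = (\<Sum>j\<in>UNIV. Z_up P X J w x a $ i $ j * v j a)"
  proof -
    have "Z_up P X J w x a $ i $ j = (\<integral>\<omega>. h j \<omega> \<partial>P x i)" for j
      by (simp add: Z_up_def h_def)
    then show ?thesis using int_h by simp
  qed
  ultimately show ?thesis
    by (simp add: expectation_mart[OF x] LIMSEQ_const_iff)
qed

end

end

section \<open>Laplace transforms\<close>

text \<open>Formulated for vector values to serve both the matrix and its entries. The second bound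
  is uniform in t \<ge> s because the iteration evaluates the transform at all arguments s /
  p_alpha.\<close>

lemma laplace_integrable:
  fixes f :: "real \<Rightarrow> 'b::euclidean_space"
  assumes f: "continuous_on UNIV f" and bound: "\<And>a. 0 \<le> a \<Longrightarrow> norm (f a) \<le> C * exp (\<kappa> * a)"
    and s: "\<kappa> < s"
  shows "set_integrable lborel {0..} (\<lambda>a. exp (- s * a) *\<^sub>R f a)"
    and "s \<le> t \<Longrightarrow> norm (LINT a:{0..}|lborel. exp (- t * a) *\<^sub>R f a) \<le> C / (s - \<kappa>)"
proof -
  have [measurable]: "f \<in> borel_measurable borel"
    using f by (rule borel_measurable_continuous_onI)
  have C: "0 \<le> C" using bound[of 0] norm_ge_zero[of "f 0"] by (simp del: norm_ge_zero)
  have g: "has_bochner_integral lborel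
      (\<lambda>a. C / (s - \<kappa>) * ((s - \<kappa>) * exp (- (s - \<kappa>) * a) * indicator {0..} a)) (C / (s - \<kappa>) * exp (- (s - \<kappa>) * 0))"
    using s by (intro has_bochner_integral_mult_right has_bochner_integral_exponential_tail) auto
  then have g: "has_bochner_integral lborel (\<lambda>a. indicator {0..} a * (C * exp (- (s - \<kappa>) * a))) (C / (s - \<kappa>))"
    using s by (simp add: mult_ac)
  have le: "norm (indicator {0..} a *\<^sub>R exp (- t * a) *\<^sub>R f a) \<le> indicator {0..} a * (C * exp (- (s - \<kappa>) * a))"
    if "s \<le> t" for a t
  proof (cases "0 \<le> a")
    case True
    have "exp (- t * a) * norm (f a) \<le> exp (- s * a) * (C * exp (\<kappa> * a))"
      using that True C by (intro mult_mono bound) (auto intro: mult_right_mono)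
    also have "\<dots> = C * exp (- (s - \<kappa>) * a)" by (simp add: mult_exp_exp algebra_simps)
    finally show ?thesis using True by simp
  qed simp
  have int: "set_integrable lborel {0..} (\<lambda>a. exp (- t * a) *\<^sub>R f a)" if "s \<le> t" for t
    unfolding set_integrable_def
  proof (rule Bochner_Integration.integrable_bound[OF integrable.intros[OF g]])
    show "AE a in lborel. norm (indicator {0..} a *\<^sub>R exp (- t * a) *\<^sub>R f a)
        \<le> norm (indicator {0..} a * (C * exp (- (s - \<kappa>) * a)))"
      using le[OF that] C by (intro AE_I2) (simp add: abs_mult)
  qed measurable
  show "set_integrable lborel {0..} (\<lambda>a. exp (- s * a) *\<^sub>R f a)" by (rule int) simp
  assume t: "s \<le> t"
  have "norm (LINT a:{0..}|lborel. exp (- t * a) *\<^sub>R f a) \<le> (\<integral>a. indicator {0..} a * (C * exp (- (s - \<kappa>) * a)) \<partial>lborel)"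
    unfolding set_lebesgue_integral_def
    using int[OF t] integrable.intros[OF g] le[OF t]
    by (intro Bochner_Integration.integral_norm_bound_integral) (auto simp: set_integrable_def)
  also have "\<dots> = C / (s - \<kappa>)" using g by (rule has_bochner_integral_integral_eq)
  finally show "norm (LINT a:{0..}|lborel. exp (- t * a) *\<^sub>R f a) \<le> C / (s - \<kappa>)" .
qed

text \<open>The fundamental theorem is applied to exp(-s a) f(a) on [0, b], and b tends to infinity;
  the growth bound with \<open>\<kappa>\<close> < s removes the boundary term at b. Only f is
  assumed to be bounded this way, so the integrability for f' is a separate hypothesis.\<close>

lemma laplace_derivative:
  fixes f f' :: "real \<Rightarrow> real"
  assumes f: "\<And>a. (f has_real_derivative f' a) (at a)" and f': "continuous_on UNIV f'"
    and bound: "\<And>a. 0 \<le> a \<Longrightarrow> \<bar>f a\<bar> \<le> C * exp (\<kappa> * a)" and s: "\<kappa> < s"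
    and int': "set_integrable lborel {0..} (\<lambda>a. exp (- s * a) * f' a)"
  shows "(LINT a:{0..}|lborel. exp (- s * a) * f' a) = s * (LINT a:{0..}|lborel. exp (- s * a) * f a) - f 0"
proof -
  have isCont: "isCont f a" "isCont f' a" for a
    using f DERIV_isCont f' by (auto simp: continuous_on_eq_continuous_at)
  have contf: "continuous_on UNIV f"
    by (simp add: continuous_on_eq_continuous_at isCont)
  have int: "set_integrable lborel {0..} (\<lambda>a. exp (- s * a) * f a)"
    using laplace_integrable(1)[OF contf, of C \<kappa> s] bound s by simp
  let ?F = "\<lambda>a. exp (- s * a) * f a"
  let ?g = "\<lambda>a. exp (- s * a) * f' a - s * (exp (- s * a) * f a)"
  have ints: "set_integrable lborel {0..} ?g"
    using int int' by (intro set_integral_diff set_integrable_mult_right) auto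
  have ftc: "(LINT a:{0..b}|lborel. ?g a) = ?F b - ?F 0" if "0 \<le> b" for b
  proof -
    have "(\<integral>a. ?g a * indicator {0..b} a \<partial>lborel) = ?F b - ?F 0"
    proof (rule integral_FTC_Icc_real[OF that])
      show "(?F has_real_derivative ?g a) (at a)" for a
        by (auto intro!: derivative_eq_intros f)
      show "isCont ?g a" for a
        by (intro continuous_intros isCont)
    qed
    then show ?thesis by (simp add: set_lebesgue_integral_def mult_ac)
  qed
  have ev: "\<forall>\<^sub>F b in at_top. ?F b - ?F 0 = (LINT a:{0..b}|lborel. ?g a)"
    using eventually_ge_at_top[of 0] by eventually_elim (simp only: ftc)
  have "(?F \<longlongrightarrow> 0) at_top"
  proof (rule Lim_null_comparison)
    show "\<forall>\<^sub>F b in at_top. norm (?F b) \<le> C * exp (- (s - \<kappa>) * b)"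
      using eventually_ge_at_top[of 0]
    proof eventually_elim
      case (elim b)
      have "exp (- s * b) * \<bar>f b\<bar> \<le> exp (- s * b) * (C * exp (\<kappa> * b))"
        by (intro mult_left_mono bound elim) auto
      also have "\<dots> = C * exp (- (s - \<kappa>) * b)" by (simp add: mult_exp_exp algebra_simps)
      finally show ?case by (simp add: abs_mult)
    qed
    have "filterlim (\<lambda>b. - (s - \<kappa>) * b) at_bot at_top"
      using s by (intro filterlim_tendsto_neg_mult_at_bot[OF tendsto_const _ filterlim_ident]) auto
    then show "((\<lambda>b. C * exp (- (s - \<kappa>) * b)) \<longlongrightarrow> 0) at_top"
      by (intro tendsto_mult_right_zero filterlim_compose[OF exp_at_bot])
  qed
  then have "((\<lambda>b. ?F b - ?F 0) \<longlongrightarrow> 0 - ?F 0) at_top"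
    by (intro tendsto_diff tendsto_const)
  then have "((\<lambda>b. LINT a:{0..b}|lborel. ?g a) \<longlongrightarrow> 0 - ?F 0) at_top"
    by (rule Lim_transform_eventually[OF _ ev])
  moreover have "((\<lambda>b. LINT a:{0..b}|lborel. ?g a) \<longlongrightarrow> (LINT a:{0..}|lborel. ?g a)) at_top"
    by (rule tendsto_set_lebesgue_integral_at_top[OF _ ints]) simp
  ultimately have "(LINT a:{0..}|lborel. ?g a) = - f 0"
    using tendsto_unique[OF trivial_limit_at_top_linorder] by fastforce
  moreover have "(LINT a:{0..}|lborel. ?g a) = (LINT a:{0..}|lborel. exp (- s * a) * f' a)
      - s * (LINT a:{0..}|lborel. exp (- s * a) * f a)"
    using int int' by simp
  ultimately show ?thesis by simp
qed

lemma laplace_scale: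
  fixes f :: "real \<Rightarrow> real"
  assumes r: "0 < r"
  shows "(LINT a:{0..}|lborel. exp (- s * a) * f (r * a)) = (LINT a:{0..}|lborel. exp (- (s / r) * a) * f a) / r"
proof -
  have "(LINT a:{0..}|lborel. exp (- (s / r) * a) * f a)
    = r * (\<integral>a. indicator {0..} (r * a) * (exp (- (s / r) * (r * a)) * f (r * a)) \<partial>lborel)"
    unfolding set_lebesgue_integral_def
    using r by (subst lborel_integral_real_affine[where c=r and t=0]) auto
  also have "(\<lambda>a. indicator {0..} (r * a) * (exp (- (s / r) * (r * a)) * f (r * a)))
    = (\<lambda>a. indicator {0..} a *\<^sub>R (exp (- s * a) * f (r * a)))"
    using r by (auto simp: indicator_def zero_le_mult_iff)
  finally show ?thesis using r by (simp add: set_lebesgue_integral_def)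
qed

lemma norm_le_row_sum_norm:
  fixes M :: "real^'m^'m::finite"
  shows "norm M \<le> CARD('m) * row_sum_norm M"
proof -
  have "norm M \<le> (\<Sum>i\<in>UNIV. norm (M $ i))"
    unfolding norm_vec_def by (rule L2_set_le_sum) simp
  also have "\<dots> \<le> (\<Sum>i\<in>(UNIV::'m set). row_sum_norm M)"
  proof (rule sum_mono)
    fix i
    have "norm (M $ i) \<le> (\<Sum>j\<in>UNIV. \<bar>M $ i $ j\<bar>)" by (rule norm_le_l1_cart)
    also have "\<dots> \<le> row_sum_norm M" unfolding row_sum_norm_def by (rule Max_ge) auto
    finally show "norm (M $ i) \<le> row_sum_norm M" .
  qed
  finally show ?thesis by simp
qed

text \<open>A right inverse of a square matrix is two-sided, so the single identity
  \<open>Z V = I\<close> gives both the invertibility of Z and its inverse.\<close>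

lemma matrix_inv_eqI:
  fixes A B :: "real^'m^'m::finite"
  assumes "A ** B = mat 1"
  shows "matrix_inv A = B"
proof -
  have BA: "B ** A = mat 1" using assms by (simp add: matrix_left_right_inverse)
  have "A ** matrix_inv A = mat 1"
    using assms BA someI[of "\<lambda>A'. A ** A' = mat 1 \<and> A' ** A = mat 1" B] by (simp add: matrix_inv_def)
  then have "B = B ** (A ** matrix_inv A)" by (simp add: matrix_mul_rid)
  also have "\<dots> = matrix_inv A" by (simp add: matrix_mul_assoc BA matrix_mul_lid)
  finally show ?thesis by simp
qed

section \<open>Identification of U and the functional equation of its transform\<close>

context level_phase_process
begin

text \<open>The column index comes first: each column solves the scalar system separately.\<close>

definition V_entry :: "real \<Rightarrow> 'm \<Rightarrow> 'm \<Rightarrow> real \<Rightarrow> real" where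
  "V_entry w j = panto (z_par c lam w) (\<lambda>i k. c i * lam i * Q $ i $ k) p (\<lambda>i. of_bool (i = j))"

lemma p_abs_le_1: "\<bar>p i\<bar> \<le> 1"
  using p_bounds[of i] by simp

lemma V_entry_0: "V_entry w j i 0 = of_bool (i = j)"
  by (simp add: V_entry_def)

lemma continuous_on_V_entry: "continuous_on S (V_entry w j i)"
  unfolding V_entry_def by (rule continuous_on_panto) (rule p_abs_le_1)

lemma V_entry_has_derivative:
  "(V_entry w j i has_real_derivative
     z_par c lam w i * V_entry w j i x - c i * lam i * (\<Sum>k\<in>UNIV. Q $ i $ k * V_entry w j k (p i * x))) (at x)"
  using panto_has_derivative[of p "z_par c lam w" "\<lambda>i k. c i * lam i * Q $ i $ k", OF p_abs_le_1]
  by (simp add: V_entry_def sum_distrib_left mult.assoc)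

lemma U_mat_eq_V_entry:
  assumes "0 < w" "0 \<le> a"
  shows "U_mat P X J w a = (\<chi> i j. V_entry w j i a)"
proof -
  have "(\<Sum>k\<in>UNIV. Z_up P X J w 0 a $ i $ k * V_entry w j k a) = of_bool (i = j)" for i j
    using Z_up_solution[OF assms V_entry_has_derivative, of 0 i j] assms by (simp add: V_entry_0)
  then have "Z_up P X J w 0 a ** (\<chi> i j. V_entry w j i a) = mat 1"
    by (simp add: matrix_matrix_mult_def mat_def vec_eq_iff)
  then show ?thesis unfolding U_mat_def by (rule matrix_inv_eqI)
qed

text \<open>The delayed argument p i * a moves the transform to s / p i and contributes 1 / p i,
  which turns c i * lam i into gamma.\<close>

lemma laplace_V_entry_equation:
  assumes bound: "\<And>k a. 0 \<le> a \<Longrightarrow> \<bar>V_entry w j k a\<bar> \<le> C * exp (\<kappa> * a)"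
    and s: "0 < s" "\<kappa> < s"
  shows "(s - z_par c lam w i) * (LINT a:{0..}|lborel. exp (- s * a) * V_entry w j i a)
    = of_bool (i = j) - gamma_par c lam p i *
      (\<Sum>k\<in>UNIV. Q $ i $ k * (LINT a:{0..}|lborel. exp (- (s / p i) * a) * V_entry w j k a))"
proof -
  let ?v' = "\<lambda>x. z_par c lam w i * V_entry w j i x - c i * lam i * (\<Sum>k\<in>UNIV. Q $ i $ k * V_entry w j k (p i * x))"
  have cont: "continuous_on UNIV (\<lambda>x. V_entry w j k (p i * x))" for k
    by (rule continuous_on_compose2[OF continuous_on_V_entry[of UNIV]]) (auto intro!: continuous_intros)
  have int: "set_integrable lborel {0..} (\<lambda>a. exp (- s * a) * V_entry w j i a)"
    using laplace_integrable(1)[OF continuous_on_V_entry, of w j i C \<kappa> s] bound s by simp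
  \<comment> \<open>The delayed function grows at rate \<open>\<kappa> * p i\<close>. For negative
    \<open>\<kappa>\<close> this exceeds \<open>\<kappa>\<close>, and 0 < s is used in its
    place.\<close>
  have "\<kappa> * p i < s"
  proof (cases "0 \<le> \<kappa>")
    case True
    then have "\<kappa> * p i \<le> \<kappa> * 1" using p_bounds[of i] by (intro mult_left_mono) auto
    then show ?thesis using s by simp
  next
    case False
    then have "\<kappa> * p i < 0" using p_bounds(1)[of i] by (simp add: mult_neg_pos)
    then show ?thesis using s by simp
  qed
  moreover have "\<bar>V_entry w j k (p i * a)\<bar> \<le> C * exp (\<kappa> * p i * a)" if "0 \<le> a" for k a
    using bound[of "p i * a" k] that p_bounds(1)[of i] by (simp add: mult_ac)
  ultimately have intp: "set_integrable lborel {0..} (\<lambda>a. exp (- s * a) * V_entry w j k (p i * a))" for k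
    using laplace_integrable(1)[OF cont, of k C "\<kappa> * p i" s] by simp
  let ?S = "\<lambda>a. \<Sum>k\<in>UNIV. Q $ i $ k * (exp (- s * a) * V_entry w j k (p i * a))"
  have intq: "set_integrable lborel {0..} (\<lambda>a. Q $ i $ k * (exp (- s * a) * V_entry w j k (p i * a)))" for k
    by (intro set_integrable_mult_right intp)
  have intS: "set_integrable lborel {0..} ?S"
    using intq unfolding set_integrable_def scaleR_sum_right by (rule Bochner_Integration.integrable_sum)
  have eq: "exp (- s * a) * ?v' a = z_par c lam w i * (exp (- s * a) * V_entry w j i a) - c i * lam i * ?S a" for a
    by (simp add: algebra_simps sum_distrib_left)
  have int': "set_integrable lborel {0..} (\<lambda>a. exp (- s * a) * ?v' a)"
    unfolding eq using int intS by (intro set_integral_diff set_integrable_mult_right) auto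
  have "s * (LINT a:{0..}|lborel. exp (- s * a) * V_entry w j i a) - V_entry w j i 0
      = (LINT a:{0..}|lborel. exp (- s * a) * ?v' a)"
    by (rule laplace_derivative[OF V_entry_has_derivative _ bound s(2) int', symmetric])
       (auto intro!: continuous_intros continuous_on_V_entry cont)
  also have "\<dots> = z_par c lam w i * (LINT a:{0..}|lborel. exp (- s * a) * V_entry w j i a)
      - c i * lam i * (LINT a:{0..}|lborel. ?S a)"
    unfolding eq using int intS by (subst set_integral_diff) auto
  also have "(LINT a:{0..}|lborel. ?S a) = (\<Sum>k\<in>UNIV. Q $ i $ k * (LINT a:{0..}|lborel. exp (- s * a) * V_entry w j k (p i * a)))"
  proof -
    have "(LINT a:{0..}|lborel. ?S a) = (\<Sum>k\<in>UNIV. LINT a:{0..}|lborel. Q $ i $ k * (exp (- s * a) * V_entry w j k (p i * a)))"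
      using intq unfolding set_lebesgue_integral_def set_integrable_def scaleR_sum_right
      by (rule Bochner_Integration.integral_sum)
    then show ?thesis by (simp only: set_integral_mult_right)
  qed
  also have "\<dots> = (\<Sum>k\<in>UNIV. Q $ i $ k * (LINT a:{0..}|lborel. exp (- (s / p i) * a) * V_entry w j k a)) / p i"
    by (simp only: laplace_scale[OF p_bounds(1)] sum_divide_distrib times_divide_eq_right)
  finally show ?thesis by (simp add: V_entry_0 gamma_par_def algebra_simps)
qed

end

text \<open>Integrability and convergence belong to the conclusion because the Lebesgue integral and
  \<open>suminf\<close> are total; the equation alone would not say that either side is
  meaningful.\<close>

theorem corollary3p3:
  fixes c lam p :: "'m::finite \<Rightarrow> real"
    and Q :: "real^'m^'m"
    and N :: "'a measure"
    and P :: "real \<Rightarrow> 'm \<Rightarrow> 'a measure"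
    and X :: "real \<Rightarrow> 'a \<Rightarrow> real"
    and J :: "real \<Rightarrow> 'a \<Rightarrow> 'm"
    and T :: "nat \<Rightarrow> 'a \<Rightarrow> real"
    and Y :: "nat \<Rightarrow> 'a \<Rightarrow> 'm"
    and w C\<^sub>1 \<kappa> s :: real
  assumes "level_phase_process c lam p Q N P X J T Y"
    and "w > 0"
    and "\<And>a. a \<ge> 0 \<Longrightarrow> row_sum_norm (U_mat P X J w a) \<le> C\<^sub>1 * exp (\<kappa> * a)"
    and "s > max (MAX i. z_par c lam w i) \<kappa>"
  shows "set_integrable lborel {0..} (\<lambda>a. exp (- s * a) *\<^sub>R U_mat P X J w a)
    \<and> R_converges c lam p Q w (\<lambda>s. A_mat c lam p w s ** B_mat c lam p) s
    \<and> laplace_mat (U_mat P X J w) s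
        = R_op c lam p Q w (\<lambda>s. A_mat c lam p w s ** B_mat c lam p) s"
proof -
  interpret level_phase_process c lam p Q N P X J T Y by (rule assms(1))
  \<comment> \<open>U is identified with V only for a \<ge> 0. M is the continuous extension to the
    whole line that \<open>laplace_integrable\<close> asks for, and the transform does not see the
    difference.\<close>
  define M where "M a = (\<chi> i j. V_entry w j i a)" for a
  define C where "C = CARD('m) * C\<^sub>1"
  have U: "U_mat P X J w a = M a" if "0 \<le> a" for a
    using U_mat_eq_V_entry[OF assms(2) that] by (simp add: M_def)
  have M_bound: "norm (M a) \<le> C * exp (\<kappa> * a)" if "0 \<le> a" for a
  proof -
    have "norm (M a) \<le> CARD('m) * row_sum_norm (M a)" by (rule norm_le_row_sum_norm)
    also have "\<dots> \<le> CARD('m) * (C\<^sub>1 * exp (\<kappa> * a))"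
      using assms(3)[OF that] by (intro mult_left_mono) (auto simp: U that)
    finally show ?thesis by (simp add: C_def)
  qed
  have entry_le: "\<bar>A $ i $ j\<bar> \<le> norm A" for A :: "real^'m^'m" and i j
    using component_le_norm_cart[of "A $ i" j] Finite_Cartesian_Product.norm_nth_le[of A i] by linarith
  have V_bound: "\<bar>V_entry w j i a\<bar> \<le> C * exp (\<kappa> * a)" if "0 \<le> a" for i j a
    using entry_le[of "M a" i j] M_bound[OF that] by (simp add: M_def)
  have M_cont: "continuous_on UNIV M"
    unfolding M_def by (intro continuous_on_vec_lambda continuous_on_V_entry)
  have z: "z_par c lam w i < s" for i
    using assms(4) Max_ge[of "range (z_par c lam w)" "z_par c lam w i"] by auto
  have s: "0 < s" "\<kappa> < s"
  proof -
    have "0 < z_par c lam w i" for i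
      unfolding z_par_def by (intro mult_pos_pos add_pos_pos c_pos rate_pos assms(2))
    then show "0 < s" using z by (rule less_trans)
  qed (use assms(4) in simp)
  have int: "set_integrable lborel {0..} (\<lambda>a. exp (- t * a) *\<^sub>R M a)" if "s \<le> t" for t
    using laplace_integrable(1)[OF M_cont M_bound, of t] s that by simp
  have lap: "laplace_mat (U_mat P X J w) t = (LINT a:{0..}|lborel. exp (- t * a) *\<^sub>R M a)" for t
    unfolding laplace_mat_def by (rule set_lebesgue_integral_cong) (auto simp: U)
  have lap_nth: "laplace_mat (U_mat P X J w) t $ i $ j = (LINT a:{0..}|lborel. exp (- t * a) * V_entry w j i a)"
    if "s \<le> t" for t i j
  proof -
    have "bounded_linear (\<lambda>A :: real^'m^'m. A $ i $ j)"
      by (rule bounded_linear_compose[OF bounded_linear_vec_nth bounded_linear_vec_nth])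
    from integral_bounded_linear[OF this int[OF that, unfolded set_integrable_def]]
    show ?thesis by (simp add: lap set_lebesgue_integral_def M_def mult.assoc)
  qed
  \<comment> \<open>The factors gamma cancel and the sign of B reverses the difference, so
    \<open>A B\<close> is the transform of the diagonal matrix with entries exp(z_i a).\<close>
  have AB_nth: "(A_mat c lam p w t ** B_mat c lam p) $ i $ j = of_bool (i = j) / (t - z_par c lam w i)"
    if "s \<le> t" for t i j
  proof -
    have g: "gamma_par c lam p i \<noteq> 0"
      using c_pos[of i] rate_pos[of i] p_bounds(1)[of i] by (simp add: gamma_par_def)
    have "(A_mat c lam p w t ** B_mat c lam p) $ i $ j
        = (\<Sum>k\<in>UNIV. if k = i then gamma_par c lam p i / (z_par c lam w i - t) * - (of_bool (i = j) / gamma_par c lam p i) else 0)"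
      unfolding matrix_matrix_mult_def A_mat_def B_mat_def diag_mat_def vec_lambda_beta
      by (intro sum.cong) auto
    then show ?thesis using z[of i] that g by (simp add: field_simps)
  qed
  have solve: "u = d / (t - \<zeta>) + g / (\<zeta> - t) * S" if "(t - \<zeta>) * u = d - g * S" "\<zeta> < t" for t \<zeta> u d g S :: real
  proof -
    have "g / (\<zeta> - t) = - (g / (t - \<zeta>))"
      by (simp only: minus_divide_right minus_diff_eq)
    moreover have "u = (d - g * S) / (t - \<zeta>)"
      using that by (simp add: eq_divide_eq mult.commute)
    ultimately show ?thesis by (simp add: diff_divide_distrib)
  qed
  have "R_converges c lam p Q w (\<lambda>s. A_mat c lam p w s ** B_mat c lam p) s
    \<and> laplace_mat (U_mat P X J w) s
        = R_op c lam p Q w (\<lambda>s. A_mat c lam p w s ** B_mat c lam p) s"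
  proof (rule R_op_eqI[OF p_bounds s(1) z Q_nonneg Q_row_sum])
    fix t i j assume t: "s \<le> t"
    have le: "t \<le> t / p i"
      using t s p_bounds[of i] by (simp add: pos_le_divide_eq mult_left_le)
    have "(t - z_par c lam w i) * laplace_mat (U_mat P X J w) t $ i $ j
        = of_bool (i = j) - gamma_par c lam p i * (\<Sum>k\<in>UNIV. Q $ i $ k * laplace_mat (U_mat P X J w) (t / p i) $ k $ j)"
      using laplace_V_entry_equation[where C=C and \<kappa>=\<kappa> and s=t and i=i and j=j and w=w] V_bound t s le
      by (simp add: lap_nth)
    then show "laplace_mat (U_mat P X J w) t $ i $ j = (A_mat c lam p w t ** B_mat c lam p) $ i $ j
        + gamma_par c lam p i / (z_par c lam w i - t) *
          (\<Sum>k\<in>UNIV. Q $ i $ k * laplace_mat (U_mat P X J w) (t / p i) $ k $ j)"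
      unfolding AB_nth[OF t] using z[of i] t by (intro solve) auto
    \<comment> \<open>The given growth bound enters the estimate of the remainder here: one constant
      bounds the transform on the whole half-line t \<ge> s.\<close>
    show "\<bar>laplace_mat (U_mat P X J w) t $ i $ j\<bar> \<le> C / (s - \<kappa>)"
      using entry_le[of "laplace_mat (U_mat P X J w) t" i j]
        laplace_integrable(2)[OF M_cont M_bound s(2) t] by (simp add: lap)
    have "\<bar>(A_mat c lam p w t ** B_mat c lam p) $ i $ j\<bar> \<le> 1 / (s - z_par c lam w i)"
      using z[of i] t by (auto simp: AB_nth intro!: frac_le)
    also have "\<dots> \<le> (\<Sum>i\<in>UNIV. 1 / (s - z_par c lam w i))"
      using z by (intro member_le_sum[where f="\<lambda>i. 1 / (s - z_par c lam w i)"]) (auto simp: less_imp_le)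
    finally show "\<bar>(A_mat c lam p w t ** B_mat c lam p) $ i $ j\<bar> \<le> (\<Sum>i\<in>UNIV. 1 / (s - z_par c lam w i))" .
  qed
  moreover have "set_integrable lborel {0..} (\<lambda>a. exp (- s * a) *\<^sub>R U_mat P X J w a)"
    using int[of s] by (subst set_integrable_cong[OF refl refl]) (auto simp: U)
  ultimately show ?thesis by blast
qed

end
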